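(* (1) Let $\lambda=\lambda(\rho)>0$ be a function of the sparsity with $\lambda(\rho)=o\big(\sqrt{\tfrac1\rho\log\tfrac1\rho}\big)$ as $\rho\to0$. Then approximate recovery is information-theoretically impossible: there do not exist constants $c>0$, $\rho_0\in(0,1)$ and, for each $\rho\in(0,\rho_0)$, a sequence of estimators $\hat v_N=\hat v_N(A)\in\Sigma_N(\rho_N)$ such that for every $\rho\in(0,\rho_0)$, in the model with parameters $(\lambda(\rho),\rho)$, $\inf_{v\in\Sigma_N(\rho_N)}\mathbb P\big((v,\hat v_N)>c\rho N\big)\to1$ as $N\to\infty$. (2) For every $\varepsilon>0$ there exist $c=c(\varepsilon)>0$ and $\rho_0=\rho_0(\varepsilon)>0$ such that for all $\rho\in(0,\rho_0)$ and all $\lambda>(2+\varepsilon)\sqrt{\tfrac1\rho\log\tfrac1\rho}$, the maximum likelihood estimator $\hat v_{ML}\in\operatorname{argmax}_{x\in\Sigma_N(\rho_N)}(x,Ax)$ recovers the support approximately: $\inf_{v\in\Sigma_N(\rho_N)}\mathbb P\big((v,\hat v_{ML})>c\rho N\big)\to1$ as $N\to\infty$.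
   Context: For $\rho\in(0,1)$ let $\rho_N\to\rho$ be such that $N\rho_N\in\mathbb N$ and $N\rho\in(N\rho_N-1/2,N\rho_N+1/2]$. For $r$ with $Nr\in\mathbb N$ let $\Sigma_N(r)=\{x\in\{0,1\}^N:\sum_i x_i=Nr\}$. The model: for an unknown $v\in\Sigma_N(\rho_N)$ and $\lambda>0$ (independent of $N$) one observes the symmetric $N\times N$ matrix $A=\frac{\lambda}{N}vv^T+W$, where $W$ is symmetric with $\{W_{ij}:i\le j\}$ independent centered Gaussians, of variance $1/N$ for $i<j$ and $2/N$ for $i=j$. $(\cdot,\cdot)$ is the Euclidean inner product. Estimators are functions of $A$ (they may depend on $N,\rho,\lambda$ but not on $v$). Estimators $\hat v_N(A)\in\Sigma_N(\rho_N)$ recover the support of $v$ approximately if there is $c>0$, independent of $N$ and $\rho$, with $(v,\hat v_N)>c\rho N$ with high probability as $N\to\infty$. The problem is studied in the limit $N\to\infty$ followed by $\rho\to0$. *)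

theory Defs
  imports "HOL-Probability.Probability" "HOL-Library.Landau_Symbols"
begin

text \<open>
  Vectors of length \<open>N\<close> are functions on \<open>{..<N}\<close> and matrices are functions on
  \<open>{..<N} \<times> {..<N}\<close>, extended by \<^const>\<open>undefined\<close> outside (as in \<^const>\<open>PiE\<close>, \<^const>\<open>PiM\<close>).
\<close>

definition inner_prod :: "nat \<Rightarrow> (nat \<Rightarrow> real) \<Rightarrow> (nat \<Rightarrow> real) \<Rightarrow> real" where
  "inner_prod N x y = (\<Sum>i<N. x i * y i)"

definition mat_vec :: "nat \<Rightarrow> (nat \<times> nat \<Rightarrow> real) \<Rightarrow> (nat \<Rightarrow> real) \<Rightarrow> nat \<Rightarrow> real" where
  "mat_vec N A x = (\<lambda>i\<in>{..<N}. \<Sum>j<N. A (i, j) * x j)"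

definition sparse_vecs :: "nat \<Rightarrow> real \<Rightarrow> (nat \<Rightarrow> real) set" where
  "sparse_vecs N r = {x \<in> {..<N} \<rightarrow>\<^sub>E {0, 1}. (\<Sum>i<N. x i) = real N * r}"

text \<open>The ceiling is the unique integer \<open>k\<close> with \<open>k - 1/2 < N \<rho> \<le> k + 1/2\<close>; see the lemma below.\<close>

definition rho_seq :: "real \<Rightarrow> nat \<Rightarrow> real" where
  "rho_seq \<rho> N = real_of_int \<lceil>real N * \<rho> - 1/2\<rceil> / real N"

lemma rho_seq_iff:
  assumes "0 < \<rho>" "0 < N"
  shows "r = rho_seq \<rho> N \<longleftrightarrow>
    real N * r \<in> \<nat> \<and> real N * \<rho> \<in> {real N * r - 1/2 <.. real N * r + 1/2}"
proof
  assume r: "r = rho_seq \<rho> N"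
  have "0 < real N * \<rho>" using assms by simp
  then have "0 \<le> \<lceil>real N * \<rho> - 1/2\<rceil>" by linarith
  then have "real_of_int \<lceil>real N * \<rho> - 1/2\<rceil> \<in> \<nat>"
    by (metis of_nat_in_Nats of_int_of_nat_eq zero_le_imp_eq_int)
  moreover have "real N * r = real_of_int \<lceil>real N * \<rho> - 1/2\<rceil>"
    using assms r by (simp add: rho_seq_def)
  ultimately show "real N * r \<in> \<nat> \<and> real N * \<rho> \<in> {real N * r - 1/2 <.. real N * r + 1/2}"
    by (auto; linarith)
next
  assume a: "real N * r \<in> \<nat> \<and> real N * \<rho> \<in> {real N * r - 1/2 <.. real N * r + 1/2}"
  then obtain k :: nat where k: "real N * r = real k" by (auto elim: Nats_cases)
  have "\<lceil>real N * \<rho> - 1/2\<rceil> = int k"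
    by (rule ceiling_unique) (use a k in auto)
  then show "r = rho_seq \<rho> N"
    using assms k by (simp add: rho_seq_def field_simps)
qed

definition sym_matrices :: "nat \<Rightarrow> (nat \<times> nat \<Rightarrow> real) measure" where
  "sym_matrices N = restrict_space (\<Pi>\<^sub>M p\<in>{..<N} \<times> {..<N}. borel)
     {A. \<forall>i<N. \<forall>j<N. A (i, j) = A (j, i)}"

text \<open>
  Joint law of the independent entries \<open>W\<^sub>i\<^sub>j\<close>, \<open>i \<le> j\<close>.  The second argument of
  \<^const>\<open>normal_density\<close> is the standard deviation.
\<close>

definition noise :: "nat \<Rightarrow> (nat \<times> nat \<Rightarrow> real) measure" where
  "noise N = (\<Pi>\<^sub>M (i, j)\<in>{(i, j). i \<le> j \<and> j < N}.
     density lborel (normal_density 0 (sqrt (if i = j then 2 / real N else 1 / real N))))"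

definition observation ::
    "nat \<Rightarrow> real \<Rightarrow> (nat \<Rightarrow> real) \<Rightarrow> (nat \<times> nat \<Rightarrow> real) \<Rightarrow> nat \<times> nat \<Rightarrow> real" where
  "observation N lam v W = restrict
     (\<lambda>(i, j). lam / real N * v i * v j + W (min i j, max i j)) ({..<N} \<times> {..<N})"

lemma measurable_observation: "observation N lam v \<in> noise N \<rightarrow>\<^sub>M sym_matrices N"
  unfolding sym_matrices_def
proof (rule measurable_restrict_space2)
  show "observation N lam v \<in> space (noise N) \<rightarrow> {A. \<forall>i<N. \<forall>j<N. A (i, j) = A (j, i)}"
    by (auto simp: observation_def min.commute max.commute mult_ac)
  show "observation N lam v \<in> noise N \<rightarrow>\<^sub>M (\<Pi>\<^sub>M p\<in>{..<N} \<times> {..<N}. borel)"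
    unfolding observation_def
  proof (rule measurable_restrict)
    fix p assume "p \<in> {..<N} \<times> {..<N}"
    then obtain i j where p: "p = (i, j)" "i < N" "j < N" by auto
    have *: "sets (noise N) = sets (\<Pi>\<^sub>M p\<in>{(i, j). i \<le> j \<and> j < N}. (borel :: real measure))"
      unfolding noise_def by (intro sets_PiM_cong) auto
    have "(\<lambda>W. W (min i j, max i j)) \<in> borel_measurable (noise N)"
      unfolding measurable_cong_sets[OF * refl]
      by (rule measurable_component_singleton) (use p in auto)
    then show "(\<lambda>W. case p of (i, j) \<Rightarrow> lam / real N * v i * v j + W (min i j, max i j))
      \<in> noise N \<rightarrow>\<^sub>M borel"
      by (simp add: p)
  qed
qed

lemma prob_space_noise: "prob_space (noise N)"
  unfolding noise_def
  by (rule prob_space_PiM) (auto intro!: prob_space_normal_density)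

definition model :: "nat \<Rightarrow> real \<Rightarrow> (nat \<Rightarrow> real) \<Rightarrow> (nat \<times> nat \<Rightarrow> real) measure" where
  "model N lam v = distr (noise N) (sym_matrices N) (observation N lam v)"

definition estimator :: "real \<Rightarrow> nat \<Rightarrow> ((nat \<times> nat \<Rightarrow> real) \<Rightarrow> nat \<Rightarrow> real) \<Rightarrow> bool" where
  "estimator \<rho> N f \<longleftrightarrow> f \<in> sym_matrices N \<rightarrow>\<^sub>M count_space (sparse_vecs N (rho_seq \<rho> N))"

text \<open>The maximiser is almost surely unique; ties may be broken in any measurable way.\<close>

definition max_likelihood_estimator ::
    "real \<Rightarrow> nat \<Rightarrow> ((nat \<times> nat \<Rightarrow> real) \<Rightarrow> nat \<Rightarrow> real) \<Rightarrow> bool" where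
  "max_likelihood_estimator \<rho> N f \<longleftrightarrow> estimator \<rho> N f \<and>
     (\<forall>A\<in>space (sym_matrices N).
        is_arg_max (\<lambda>x. inner_prod N x (mat_vec N A x))
          (\<lambda>x. x \<in> sparse_vecs N (rho_seq \<rho> N)) (f A))"

definition success_prob ::
    "real \<Rightarrow> real \<Rightarrow> real \<Rightarrow> nat \<Rightarrow> ((nat \<times> nat \<Rightarrow> real) \<Rightarrow> nat \<Rightarrow> real) \<Rightarrow> (nat \<Rightarrow> real) \<Rightarrow> real" where
  "success_prob c lam \<rho> N f v =
     measure (model N lam v) {A \<in> space (model N lam v). inner_prod N v (f A) > c * \<rho> * real N}"

definition recovers_approx ::
    "real \<Rightarrow> real \<Rightarrow> real \<Rightarrow> (nat \<Rightarrow> (nat \<times> nat \<Rightarrow> real) \<Rightarrow> nat \<Rightarrow> real) \<Rightarrow> bool" where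
  "recovers_approx c lam \<rho> f \<longleftrightarrow>
     (\<lambda>N. INF v\<in>sparse_vecs N (rho_seq \<rho> N). success_prob c lam \<rho> N (f N) v) \<longlonglongrightarrow> 1"

end

theory Submission
  imports Defs "HOL-Real_Asymp.Real_Asymp"
begin

text \<open>
  Impossibility: average over \<open>v\<close> and change measure to pure noise.  With \<open>k = |v| \<approx> \<rho> N\<close>, the
  likelihood ratio \<open>L\<^sub>v\<close> has second moment \<open>exp (\<lambda>\<^sup>2 k\<^sup>2 / (2 N)) = exp (o(\<rho> log (1/\<rho>)) N)\<close>,
  whereas a guess made independently of \<open>v\<close> has overlap above \<open>c \<rho> N\<close> with only a fraction
  \<open>4\<^sup>k (k/N)\<close> to the power \<open>c \<rho> N\<close>, i.e. \<open>exp (- c \<rho> log (1/\<rho>) (1 + o(1)) N)\<close>, of all \<open>v\<close>.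
  Truncating \<open>L\<^sub>v\<close> at \<open>exp (\<alpha> N)\<close> with \<open>\<alpha> = c \<rho> log (1/\<rho>) / 4\<close> beats both.

  Maximum likelihood: \<open>(x, W x)\<close> is a centered Gaussian of variance \<open>2 k\<^sup>2 / N\<close>, so by a union
  bound over the at most \<open>exp (k log (1/\<rho>) + \<rho> N)\<close> candidates its maximum is about
  \<open>2 \<rho> \<surd>(\<rho> log (1/\<rho>)) N\<close>, which is less than the signal gap
  \<open>\<lambda> (k\<^sup>2 - (v, x)\<^sup>2) / N\<close> if the overlap \<open>(v, x)\<close> is small and \<open>\<lambda>\<close> above the threshold.
\<close>

section \<open>Product Gaussian measures\<close>

definition gauss :: "'i set \<Rightarrow> ('i \<Rightarrow> real) \<Rightarrow> ('i \<Rightarrow> real) measure" where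
  "gauss I \<sigma> = (\<Pi>\<^sub>M i\<in>I. density lborel (normal_density 0 (\<sigma> i)))"

lemma prob_space_gauss: "(\<And>i. i \<in> I \<Longrightarrow> \<sigma> i > 0) \<Longrightarrow> prob_space (gauss I \<sigma>)"
  unfolding gauss_def by (intro prob_space_PiM prob_space_normal_density)

lemma sets_gauss: "sets (gauss I \<sigma>) = sets (\<Pi>\<^sub>M i\<in>I. (borel :: real measure))"
  unfolding gauss_def by (intro sets_PiM_cong) auto

lemma space_gauss: "space (gauss I \<sigma>) = I \<rightarrow>\<^sub>E UNIV"
  unfolding gauss_def by (simp add: space_PiM)

lemma measurable_gauss_component:
  "i \<in> I \<Longrightarrow> (\<lambda>w. w i) \<in> borel_measurable (gauss I \<sigma>)"
  unfolding measurable_cong_sets[OF sets_gauss refl] by (rule measurable_component_singleton)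

section \<open>Exponential moments and tails of Gaussian linear forms\<close>

lemma normal_density_tilt:
  assumes "\<sigma> > 0"
  shows "exp (c * x) * normal_density 0 \<sigma> x = exp (c\<^sup>2 * \<sigma>\<^sup>2 / 2) * normal_density (c * \<sigma>\<^sup>2) \<sigma> x"
proof -
  have "c * x + -(x\<^sup>2) / (2 * \<sigma>\<^sup>2) = c\<^sup>2 * \<sigma>\<^sup>2 / 2 + -((x - c * \<sigma>\<^sup>2)\<^sup>2) / (2 * \<sigma>\<^sup>2)"
    using assms by (simp add: field_simps power2_eq_square)
  then show ?thesis
    by (simp add: normal_density_def exp_add[symmetric] mult.left_commute)
qed

text \<open>By completing the square, the tilted density is again normal, with mean
  \<open>c * \<sigma>\<^sup>2\<close>, so only the prefactor survives integration.\<close>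

lemma nn_integral_exp_normal:
  assumes "\<sigma> > 0"
  shows "(\<integral>\<^sup>+x. ennreal (exp (c * x)) \<partial>density lborel (normal_density 0 \<sigma>)) = ennreal (exp (c\<^sup>2 * \<sigma>\<^sup>2 / 2))"
proof -
  have "(\<integral>\<^sup>+x. ennreal (exp (c * x)) \<partial>density lborel (normal_density 0 \<sigma>)) =
    (\<integral>\<^sup>+x. ennreal (exp (c\<^sup>2 * \<sigma>\<^sup>2 / 2)) * ennreal (normal_density (c * \<sigma>\<^sup>2) \<sigma> x) \<partial>lborel)"
    using assms by (subst nn_integral_density)
      (auto intro!: nn_integral_cong simp: ennreal_mult[symmetric] normal_density_tilt[symmetric] mult.commute[of "normal_density _ _ _"])
  also have "\<dots> = ennreal (exp (c\<^sup>2 * \<sigma>\<^sup>2 / 2)) * (\<integral>\<^sup>+x. ennreal (normal_density (c * \<sigma>\<^sup>2) \<sigma> x) \<partial>lborel)"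
    by (rule nn_integral_cmult) simp
  also have "(\<integral>\<^sup>+x. ennreal (normal_density (c * \<sigma>\<^sup>2) \<sigma> x) \<partial>lborel) = 1"
    using prob_space.emeasure_space_1[OF prob_space_normal_density[OF assms, of "c * \<sigma>\<^sup>2"]]
    by (simp add: emeasure_density)
  finally show ?thesis by simp
qed

lemma nn_integral_exp_gauss:
  assumes "finite I" "\<And>i. i \<in> I \<Longrightarrow> \<sigma> i > 0"
  shows "(\<integral>\<^sup>+w. ennreal (exp (\<Sum>i\<in>I. c i * w i)) \<partial>gauss I \<sigma>) = ennreal (exp (\<Sum>i\<in>I. (c i)\<^sup>2 * (\<sigma> i)\<^sup>2 / 2))"
proof -
  \<comment> \<open>Outside \<open>I\<close> the factor is set to a standard normal, since the
    product locale asks for a sigma-finite measure at every index.\<close>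
  define M where "M i = density lborel (normal_density 0 (if i \<in> I then \<sigma> i else 1))" for i
  have M: "prob_space (M i)" for i
    unfolding M_def using assms by (intro prob_space_normal_density) auto
  interpret product_sigma_finite M
    by (simp add: M prob_space_imp_sigma_finite product_sigma_finite_def)
  have "gauss I \<sigma> = PiM I M"
    unfolding gauss_def by (intro PiM_cong) (auto simp: M_def)
  then have "(\<integral>\<^sup>+w. ennreal (exp (\<Sum>i\<in>I. c i * w i)) \<partial>gauss I \<sigma>) = (\<integral>\<^sup>+w. (\<Prod>i\<in>I. ennreal (exp (c i * w i))) \<partial>PiM I M)"
    using assms by (simp add: exp_sum prod_ennreal)
  also have "\<dots> = (\<Prod>i\<in>I. \<integral>\<^sup>+x. ennreal (exp (c i * x)) \<partial>M i)"
    using assms by (intro product_nn_integral_prod) (auto simp: M_def)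
  also have "\<dots> = (\<Prod>i\<in>I. ennreal (exp ((c i)\<^sup>2 * (\<sigma> i)\<^sup>2 / 2)))"
    using assms by (intro prod.cong refl) (simp add: M_def nn_integral_exp_normal)
  finally show ?thesis using assms by (simp add: exp_sum prod_ennreal)
qed

text \<open>Chernoff bound: Markov's inequality for the exponential moment of the linear form, a
  centered Gaussian of variance \<open>V\<close>.\<close>

lemma gauss_tail:
  assumes "finite I" "\<And>i. i \<in> I \<Longrightarrow> \<sigma> i > 0"
    and V: "(\<Sum>i\<in>I. (c i)\<^sup>2 * (\<sigma> i)\<^sup>2) = V" "V > 0" and t: "t \<ge> 0"
  shows "measure (gauss I \<sigma>) {w \<in> space (gauss I \<sigma>). t \<le> (\<Sum>i\<in>I. c i * w i)} \<le> exp (- (t\<^sup>2 / (2 * V)))"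
proof -
  interpret prob_space "gauss I \<sigma>" using assms by (intro prob_space_gauss)
  \<comment> \<open>The minimizer of \<open>- s * t + s\<^sup>2 * V / 2\<close>, the exponent that
    Markov's inequality yields for a general \<open>s\<close>.\<close>
  define s where "s = t / V"
  define A where "A = {w \<in> space (gauss I \<sigma>). t \<le> (\<Sum>i\<in>I. c i * w i)}"
  note [measurable] = measurable_gauss_component
  have [measurable]: "A \<in> events" unfolding A_def by measurable
  have s: "s \<ge> 0" using t V by (simp add: s_def)
  have "emeasure (gauss I \<sigma>) A = (\<integral>\<^sup>+w. indicator A w \<partial>gauss I \<sigma>)" by simp
  also have "\<dots> \<le> (\<integral>\<^sup>+w. ennreal (exp (- s * t)) * ennreal (exp (\<Sum>i\<in>I. s * c i * w i)) \<partial>gauss I \<sigma>)"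
  proof (rule nn_integral_mono)
    fix w
    have "1 \<le> exp (- s * t) * exp (\<Sum>i\<in>I. s * c i * w i)" if "w \<in> A"
    proof -
      have "s * t \<le> s * (\<Sum>i\<in>I. c i * w i)" using that s by (intro mult_left_mono) (auto simp: A_def)
      then show ?thesis by (simp add: exp_add[symmetric] sum_distrib_left mult.assoc)
    qed
    then show "indicator A w \<le> ennreal (exp (- s * t)) * ennreal (exp (\<Sum>i\<in>I. s * c i * w i))"
      by (auto simp: indicator_def ennreal_mult[symmetric])
  qed
  also have "\<dots> = ennreal (exp (- s * t)) * ennreal (exp (\<Sum>i\<in>I. (s * c i)\<^sup>2 * (\<sigma> i)\<^sup>2 / 2))"
    using assms by (subst nn_integral_cmult) (auto simp: nn_integral_exp_gauss)
  also have "(\<Sum>i\<in>I. (s * c i)\<^sup>2 * (\<sigma> i)\<^sup>2 / 2) = s\<^sup>2 * V / 2"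
    unfolding V(1)[symmetric] by (simp add: sum_distrib_left sum_divide_distrib power_mult_distrib mult.assoc)
  also have "ennreal (exp (- s * t)) * ennreal (exp (s\<^sup>2 * V / 2)) = ennreal (exp (- s * t + s\<^sup>2 * V / 2))"
    by (simp add: ennreal_mult[symmetric] exp_add[symmetric])
  also have "- s * t + s\<^sup>2 * V / 2 = - (t\<^sup>2 / (2 * V))"
    using V(2) by (simp add: s_def power2_eq_square field_simps)
  finally show ?thesis unfolding A_def by (simp add: emeasure_eq_measure)
qed

section \<open>Translated Gaussian products and their likelihood ratio\<close>

definition gauss_ratio :: "'i set \<Rightarrow> ('i \<Rightarrow> real) \<Rightarrow> ('i \<Rightarrow> real) \<Rightarrow> ('i \<Rightarrow> real) \<Rightarrow> real" where
  "gauss_ratio I \<sigma> h w = exp (\<Sum>i\<in>I. h i / (\<sigma> i)\<^sup>2 * w i - (h i)\<^sup>2 / (2 * (\<sigma> i)\<^sup>2))"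

lemma measurable_gauss_ratio [measurable]: "gauss_ratio I \<sigma> h \<in> borel_measurable (gauss I \<sigma>)"
  unfolding gauss_ratio_def
  by (intro measurable_compose[OF _ borel_measurable_exp] borel_measurable_sum borel_measurable_diff borel_measurable_times
      measurable_gauss_component borel_measurable_const)

lemma measurable_gauss_shift:
  "(\<lambda>w. \<lambda>i\<in>I. w i + h i) \<in> gauss I \<sigma> \<rightarrow>\<^sub>M gauss I \<sigma>"
  unfolding measurable_cong_sets[OF refl sets_gauss]
  by (intro measurable_restrict borel_measurable_add measurable_gauss_component borel_measurable_const)

lemma normal_density_shift:
  assumes "\<sigma> > 0"
  shows "normal_density 0 \<sigma> x * exp (h / \<sigma>\<^sup>2 * x - h\<^sup>2 / (2 * \<sigma>\<^sup>2)) = normal_density h \<sigma> x"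
proof -
  have "normal_density 0 \<sigma> x * exp (h / \<sigma>\<^sup>2 * x - h\<^sup>2 / (2 * \<sigma>\<^sup>2)) =
      exp (- (h\<^sup>2 / (2 * \<sigma>\<^sup>2))) * (exp (h / \<sigma>\<^sup>2 * x) * normal_density 0 \<sigma> x)"
    by (simp add: exp_diff exp_minus field_simps)
  also have "\<dots> = exp (- (h\<^sup>2 / (2 * \<sigma>\<^sup>2))) * exp ((h / \<sigma>\<^sup>2)\<^sup>2 * \<sigma>\<^sup>2 / 2) * normal_density (h / \<sigma>\<^sup>2 * \<sigma>\<^sup>2) \<sigma> x"
    using assms by (simp only: normal_density_tilt mult.assoc)
  also have "(h / \<sigma>\<^sup>2)\<^sup>2 * \<sigma>\<^sup>2 / 2 = h\<^sup>2 / (2 * \<sigma>\<^sup>2)"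
    using assms by (simp add: field_simps power2_eq_square)
  finally show ?thesis using assms by (simp add: exp_minus)
qed

lemma distr_normal_shift:
  assumes "\<sigma> > 0"
  shows "distr (density lborel (normal_density 0 \<sigma>)) borel (\<lambda>x. x + h) = density lborel (normal_density h \<sigma>)"
proof -
  interpret prob_space "density lborel (normal_density 0 \<sigma>)"
    using assms by (rule prob_space_normal_density)
  have "distributed (density lborel (normal_density 0 \<sigma>)) lborel (\<lambda>x. x) (normal_density 0 \<sigma>)"
    by (auto simp: distributed_def distr_id2)
  from normal_density_affine[OF this assms, of 1 h] show ?thesis
    by (auto simp: distributed_def add.commute cong: distr_cong)
qed

text \<open>The Cameron-Martin formula in finite dimension. Both sides are identified with the
  product of normals of means \<open>h i\<close> by comparison on boxes, where the ratio and the
  indicator factor over the coordinates and \<open>normal_density_shift\<close> settles each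
  factor.\<close>

lemma distr_gauss_shift:
  assumes I: "finite I" and s: "\<And>i. i \<in> I \<Longrightarrow> \<sigma> i > 0"
  shows "distr (gauss I \<sigma>) (gauss I \<sigma>) (\<lambda>w. \<lambda>i\<in>I. w i + h i) = density (gauss I \<sigma>) (gauss_ratio I \<sigma> h)"
proof -
  define \<tau> where "\<tau> i = (if i \<in> I then \<sigma> i else 1)" for i
  have \<tau>: "\<tau> i > 0" for i using s by (auto simp: \<tau>_def)
  define M where "M i = density lborel (normal_density 0 (\<tau> i))" for i
  define M' where "M' i = density lborel (normal_density (h i) (\<tau> i))" for i
  have M: "prob_space (M i)" "prob_space (M' i)" for i
    unfolding M_def M'_def using \<tau> by (auto intro: prob_space_normal_density)
  interpret M: product_sigma_finite M
    by (simp add: M prob_space_imp_sigma_finite product_sigma_finite_def)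
  interpret M': product_sigma_finite M'
    by (simp add: M prob_space_imp_sigma_finite product_sigma_finite_def)
  have G: "gauss I \<sigma> = PiM I M"
    unfolding gauss_def by (intro PiM_cong) (auto simp: M_def \<tau>_def)
  have sets': "sets (PiM I M') = sets (gauss I \<sigma>)"
    unfolding sets_gauss by (intro sets_PiM_cong) (auto simp: M'_def)
  have "distr (gauss I \<sigma>) (gauss I \<sigma>) (\<lambda>w. \<lambda>i\<in>I. w i + h i) = PiM I M'"
  proof (rule M'.PiM_eqI[OF I])
    fix A assume A: "\<And>i. i \<in> I \<Longrightarrow> A i \<in> sets (M' i)"
    have "emeasure (distr (gauss I \<sigma>) (gauss I \<sigma>) (\<lambda>w. \<lambda>i\<in>I. w i + h i)) (Pi\<^sub>E I A) =
      emeasure (gauss I \<sigma>) ((\<lambda>w. \<lambda>i\<in>I. w i + h i) -` Pi\<^sub>E I A \<inter> space (gauss I \<sigma>))"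
      using A I by (intro emeasure_distr measurable_gauss_shift) (auto simp: sets'[symmetric] intro!: sets_PiM_I_finite)
    also have "(\<lambda>w. \<lambda>i\<in>I. w i + h i) -` Pi\<^sub>E I A \<inter> space (gauss I \<sigma>) = Pi\<^sub>E I (\<lambda>i. (\<lambda>x. x + h i) -` A i)"
      by (auto simp: space_gauss PiE_def Pi_def extensional_def)
    also have "emeasure (gauss I \<sigma>) \<dots> = (\<Prod>i\<in>I. emeasure (M i) ((\<lambda>x. x + h i) -` A i))"
    proof -
      have "(\<lambda>x. x + h i) -` A i \<in> sets (M i)" if "i \<in> I" for i
      proof -
        have "(\<lambda>x. x + h i) -` A i \<inter> space borel \<in> sets borel"
          using A[OF that] by (intro measurable_sets[of _ borel borel]) (auto simp: M'_def)
        then show ?thesis by (simp add: M_def)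
      qed
      then show ?thesis unfolding G using I by (intro M.emeasure_PiM)
    qed
    also have "\<dots> = (\<Prod>i\<in>I. emeasure (M' i) (A i))"
    proof (rule prod.cong[OF refl])
      fix i assume "i \<in> I"
      with A have "A i \<in> sets borel" by (auto simp: M'_def)
      then show "emeasure (M i) ((\<lambda>x. x + h i) -` A i) = emeasure (M' i) (A i)"
        unfolding M'_def distr_normal_shift[OF \<tau>[of i], of "h i", symmetric] by (subst emeasure_distr) (auto simp: M_def)
    qed
    finally show "emeasure (distr (gauss I \<sigma>) (gauss I \<sigma>) (\<lambda>w. \<lambda>i\<in>I. w i + h i)) (Pi\<^sub>E I A) = (\<Prod>i\<in>I. emeasure (M' i) (A i))" .
  qed (simp add: sets')
  moreover have "density (gauss I \<sigma>) (gauss_ratio I \<sigma> h) = PiM I M'"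
  proof (rule M'.PiM_eqI[OF I])
    fix A assume A: "\<And>i. i \<in> I \<Longrightarrow> A i \<in> sets (M' i)"
    then have A': "Pi\<^sub>E I A \<in> sets (gauss I \<sigma>)" using I by (auto simp: sets'[symmetric] intro!: sets_PiM_I_finite)
    have Ab: "A i \<in> sets borel" if "i \<in> I" for i using A[OF that] by (simp add: M'_def)
    let ?g = "\<lambda>i x. ennreal (exp (h i / (\<tau> i)\<^sup>2 * x - (h i)\<^sup>2 / (2 * (\<tau> i)\<^sup>2))) * indicator (A i) x"
    have "emeasure (density (gauss I \<sigma>) (gauss_ratio I \<sigma> h)) (Pi\<^sub>E I A) =
        (\<integral>\<^sup>+w. ennreal (gauss_ratio I \<sigma> h w) * indicator (Pi\<^sub>E I A) w \<partial>gauss I \<sigma>)"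
      using A' by (simp add: emeasure_density)
    also have "\<dots> = (\<integral>\<^sup>+w. (\<Prod>i\<in>I. ?g i (w i)) \<partial>gauss I \<sigma>)"
    proof (rule nn_integral_cong)
      fix w assume w: "w \<in> space (gauss I \<sigma>)"
      have "indicator (Pi\<^sub>E I A) w = (\<Prod>i\<in>I. indicator (A i) (w i) :: ennreal)"
        using w I by (auto simp: indicator_def space_gauss PiE_def Pi_def)
      moreover have "ennreal (gauss_ratio I \<sigma> h w) =
          (\<Prod>i\<in>I. ennreal (exp (h i / (\<tau> i)\<^sup>2 * w i - (h i)\<^sup>2 / (2 * (\<tau> i)\<^sup>2))))"
        unfolding gauss_ratio_def exp_sum[OF I] by (subst prod_ennreal) (auto simp: \<tau>_def)
      ultimately show "ennreal (gauss_ratio I \<sigma> h w) * indicator (Pi\<^sub>E I A) w = (\<Prod>i\<in>I. ?g i (w i))"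
        by (simp add: prod.distrib)
    qed
    also have "\<dots> = (\<Prod>i\<in>I. \<integral>\<^sup>+x. ?g i x \<partial>M i)"
      unfolding G using I Ab by (intro M.product_nn_integral_prod) (auto simp: M_def)
    also have "\<dots> = (\<Prod>i\<in>I. emeasure (M' i) (A i))"
    proof (rule prod.cong[OF refl])
      fix i assume "i \<in> I"
      note [measurable] = Ab[OF this]
      have "ennreal (normal_density 0 (\<tau> i) x) * ?g i x = ennreal (normal_density (h i) (\<tau> i) x) * indicator (A i) x" for x
        unfolding normal_density_shift[OF \<tau>, of i x "h i", symmetric] by (simp add: ennreal_mult mult.assoc)
      then have "(\<integral>\<^sup>+x. ?g i x \<partial>M i) = (\<integral>\<^sup>+x. ennreal (normal_density (h i) (\<tau> i) x) * indicator (A i) x \<partial>lborel)"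
        unfolding M_def by (subst nn_integral_density) auto
      then show "(\<integral>\<^sup>+x. ?g i x \<partial>M i) = emeasure (M' i) (A i)"
        by (simp add: M'_def emeasure_density)
    qed
    finally show "emeasure (density (gauss I \<sigma>) (gauss_ratio I \<sigma> h)) (Pi\<^sub>E I A) = (\<Prod>i\<in>I. emeasure (M' i) (A i))" .
  qed (simp add: sets')
  ultimately show ?thesis by simp
qed

text \<open>With \<open>?H\<close> the claimed exponent, the squared ratio is
  \<open>exp (- ?H)\<close> times the exponential of a linear form, and the exponential moment of
  that form is \<open>exp (2 * ?H)\<close>.\<close>

lemma nn_integral_gauss_ratio_square:
  assumes I: "finite I" and s: "\<And>i. i \<in> I \<Longrightarrow> \<sigma> i > 0"
  shows "(\<integral>\<^sup>+w. ennreal ((gauss_ratio I \<sigma> h w)\<^sup>2) \<partial>gauss I \<sigma>) = ennreal (exp (\<Sum>i\<in>I. (h i)\<^sup>2 / (\<sigma> i)\<^sup>2))"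
proof -
  note [measurable] = measurable_gauss_component
  let ?H = "\<Sum>i\<in>I. (h i)\<^sup>2 / (\<sigma> i)\<^sup>2"
  have "(gauss_ratio I \<sigma> h w)\<^sup>2 = exp (- ?H) * exp (\<Sum>i\<in>I. 2 * h i / (\<sigma> i)\<^sup>2 * w i)" for w
  proof -
    have "(gauss_ratio I \<sigma> h w)\<^sup>2 = exp (2 * (\<Sum>i\<in>I. h i / (\<sigma> i)\<^sup>2 * w i - (h i)\<^sup>2 / (2 * (\<sigma> i)\<^sup>2)))"
      by (simp add: gauss_ratio_def exp_double)
    also have "2 * (\<Sum>i\<in>I. h i / (\<sigma> i)\<^sup>2 * w i - (h i)\<^sup>2 / (2 * (\<sigma> i)\<^sup>2)) =
       - ?H + (\<Sum>i\<in>I. 2 * h i / (\<sigma> i)\<^sup>2 * w i)"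
      by (simp add: sum_distrib_left sum_subtractf right_diff_distrib mult.assoc)
    finally show ?thesis by (simp only: exp_add)
  qed
  then have "(\<integral>\<^sup>+w. ennreal ((gauss_ratio I \<sigma> h w)\<^sup>2) \<partial>gauss I \<sigma>) =
      ennreal (exp (- ?H)) * (\<integral>\<^sup>+w. ennreal (exp (\<Sum>i\<in>I. 2 * h i / (\<sigma> i)\<^sup>2 * w i)) \<partial>gauss I \<sigma>)"
    by (simp only: ennreal_mult exp_ge_zero) (subst nn_integral_cmult, measurable)
  also have "(\<integral>\<^sup>+w. ennreal (exp (\<Sum>i\<in>I. 2 * h i / (\<sigma> i)\<^sup>2 * w i)) \<partial>gauss I \<sigma>) =
      ennreal (exp (\<Sum>i\<in>I. (2 * h i / (\<sigma> i)\<^sup>2)\<^sup>2 * (\<sigma> i)\<^sup>2 / 2))"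
    by (rule nn_integral_exp_gauss[OF I s])
  also have "(\<Sum>i\<in>I. (2 * h i / (\<sigma> i)\<^sup>2)\<^sup>2 * (\<sigma> i)\<^sup>2 / 2) = 2 * ?H"
    unfolding sum_distrib_left
  proof (rule sum.cong[OF refl])
    fix i assume "i \<in> I"
    from s[OF this] show "(2 * h i / (\<sigma> i)\<^sup>2)\<^sup>2 * (\<sigma> i)\<^sup>2 / 2 = 2 * ((h i)\<^sup>2 / (\<sigma> i)\<^sup>2)"
      by (simp add: field_simps power2_eq_square)
  qed
  finally show ?thesis by (simp add: ennreal_mult[symmetric] exp_add[symmetric])
qed

text \<open>The likelihood ratio \<open>L\<close> is split at the level \<open>T\<close>: \<open>L \<le> T + L\<^sup>2 / T\<close>.\<close>

lemma measure_gauss_shift_le: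
  assumes I: "finite I" and s: "\<And>i. i \<in> I \<Longrightarrow> \<sigma> i > 0"
    and A: "A \<in> sets (gauss I \<sigma>)" and T: "T > 0"
  shows "measure (gauss I \<sigma>) {w \<in> space (gauss I \<sigma>). (\<lambda>i\<in>I. w i + h i) \<in> A}
    \<le> T * measure (gauss I \<sigma>) A + exp (\<Sum>i\<in>I. (h i)\<^sup>2 / (\<sigma> i)\<^sup>2) / T"
proof -
  interpret prob_space "gauss I \<sigma>" using s by (intro prob_space_gauss)
  note [measurable] = A
  let ?L = "gauss_ratio I \<sigma> h"
  have "emeasure (gauss I \<sigma>) {w \<in> space (gauss I \<sigma>). (\<lambda>i\<in>I. w i + h i) \<in> A} =
      emeasure (distr (gauss I \<sigma>) (gauss I \<sigma>) (\<lambda>w. \<lambda>i\<in>I. w i + h i)) A"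
    by (subst emeasure_distr[OF measurable_gauss_shift A]) (auto intro!: arg_cong[where f="emeasure _"])
  then have 1: "emeasure (gauss I \<sigma>) {w \<in> space (gauss I \<sigma>). (\<lambda>i\<in>I. w i + h i) \<in> A} =
      (\<integral>\<^sup>+w. ennreal (?L w) * indicator A w \<partial>gauss I \<sigma>)"
    using A by (simp only: distr_gauss_shift[OF I s] emeasure_density measurable_gauss_ratio measurable_compose[OF measurable_gauss_ratio measurable_ennreal])
  \<comment> \<open>The indicator of \<open>A\<close> is kept on the part bounded by
    \<open>T\<close> and dropped on the quadratic part, which then integrates to the full second
    moment.\<close>
  have 2: "(\<integral>\<^sup>+w. ennreal (?L w) * indicator A w \<partial>gauss I \<sigma>) \<le>
      (\<integral>\<^sup>+w. ennreal T * indicator A w + ennreal (1 / T) * ennreal ((?L w)\<^sup>2) \<partial>gauss I \<sigma>)"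
  proof (rule nn_integral_mono)
    fix w
    have L: "0 < ?L w" by (simp add: gauss_ratio_def)
    have "?L w \<le> T + 1 / T * (?L w)\<^sup>2"
    proof (cases "?L w \<le> T")
      case True
      have "0 \<le> 1 / T * (?L w)\<^sup>2" using T by simp
      with True show ?thesis by linarith
    next
      case False
      then have "?L w * T \<le> ?L w * ?L w" using L by (intro mult_left_mono) auto
      then have "?L w \<le> 1 / T * (?L w)\<^sup>2" using T by (simp add: pos_le_divide_eq power2_eq_square)
      with T show ?thesis by linarith
    qed
    then show "ennreal (?L w) * indicator A w \<le> ennreal T * indicator A w + ennreal (1 / T) * ennreal ((?L w)\<^sup>2)"
      using T L by (auto simp: indicator_def ennreal_mult[symmetric] ennreal_plus[symmetric] simp del: ennreal_plus)
  qed
  have 3: "(\<integral>\<^sup>+w. ennreal T * indicator A w + ennreal (1 / T) * ennreal ((?L w)\<^sup>2) \<partial>gauss I \<sigma>) =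
      (\<integral>\<^sup>+w. ennreal T * indicator A w \<partial>gauss I \<sigma>) +
      (\<integral>\<^sup>+w. ennreal (1 / T) * ennreal ((?L w)\<^sup>2) \<partial>gauss I \<sigma>)"
    by (intro nn_integral_add) measurable
  have 4: "(\<integral>\<^sup>+w. ennreal T * indicator A w \<partial>gauss I \<sigma>) = ennreal (T * measure (gauss I \<sigma>) A)"
    using A T by (simp add: nn_integral_cmult_indicator emeasure_eq_measure ennreal_mult)
  have 5: "(\<integral>\<^sup>+w. ennreal (1 / T) * ennreal ((?L w)\<^sup>2) \<partial>gauss I \<sigma>) =
      ennreal (1 / T) * (\<integral>\<^sup>+w. ennreal ((?L w)\<^sup>2) \<partial>gauss I \<sigma>)"
    by (intro nn_integral_cmult) measurable
  have 6: "ennreal (1 / T) * (\<integral>\<^sup>+w. ennreal ((?L w)\<^sup>2) \<partial>gauss I \<sigma>) =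
      ennreal (exp (\<Sum>i\<in>I. (h i)\<^sup>2 / (\<sigma> i)\<^sup>2) / T)"
    using T by (simp add: nn_integral_gauss_ratio_square[OF I s] flip: ennreal_mult)
  show ?thesis
    using 2 T unfolding 1[symmetric] 3 4 5 6 by (simp add: emeasure_eq_measure flip: ennreal_plus)
qed

section \<open>The quadratic form and the spike\<close>

definition upairs :: "nat \<Rightarrow> (nat \<times> nat) set" where
  "upairs N = {(i, j). i \<le> j \<and> j < N}"

definition noise_sd :: "nat \<Rightarrow> nat \<times> nat \<Rightarrow> real" where
  "noise_sd N p = sqrt (if fst p = snd p then 2 / real N else 1 / real N)"

lemma finite_upairs: "finite (upairs N)"
  by (rule finite_subset[of _ "{..<N} \<times> {..<N}"]) (auto simp: upairs_def)

lemma noise_sd_pos: "N > 0 \<Longrightarrow> noise_sd N p > 0"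
  by (simp add: noise_sd_def)

lemma noise_eq_gauss: "noise N = gauss (upairs N) (noise_sd N)"
  unfolding noise_def gauss_def upairs_def
  by (intro PiM_cong) (auto simp: noise_sd_def)

text \<open>Passes from the symmetric array to its independent entries; an off-diagonal one fills
  two positions. The induction adds the pairs \<open>(i, N)\<close>, which account for one new row
  and one new column.\<close>

lemma sum_upairs:
  fixes g :: "nat \<times> nat \<Rightarrow> real"
  shows "(\<Sum>i<N. \<Sum>j<N. g (min i j, max i j)) = (\<Sum>p\<in>upairs N. (if fst p = snd p then 1 else 2) * g p)"
proof (induction N)
  case 0
  then show ?case by (simp add: upairs_def)
next
  case (Suc N)
  have U: "upairs (Suc N) = upairs N \<union> (\<lambda>i. (i, N)) ` {..N}"
    by (auto simp: upairs_def less_Suc_eq)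
  have "(\<Sum>p\<in>upairs (Suc N). (if fst p = snd p then 1 else 2) * g p) =
      (\<Sum>p\<in>upairs N. (if fst p = snd p then 1 else 2) * g p) +
      (\<Sum>p\<in>(\<lambda>i. (i, N)) ` {..N}. (if fst p = snd p then 1 else 2) * g p)"
    unfolding U by (rule sum.union_disjoint) (auto simp: finite_upairs, auto simp: upairs_def)
  also have "(\<Sum>p\<in>(\<lambda>i. (i, N)) ` {..N}. (if fst p = snd p then 1 else 2) * g p) =
      (\<Sum>i\<le>N. (if i = N then 1 else 2) * g (i, N))"
    by (subst sum.reindex) (auto simp: inj_on_def)
  also have "\<dots> = g (N, N) + 2 * (\<Sum>i<N. g (i, N))"
    by (simp add: lessThan_Suc_atMost[symmetric] sum_distrib_left)
  also have "(\<Sum>p\<in>upairs N. (if fst p = snd p then 1 else 2) * g p) = (\<Sum>i<N. \<Sum>j<N. g (min i j, max i j))"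
    using Suc by simp
  finally show ?case by (simp add: sum.distrib)
qed

text \<open>The coefficient of the independent entry \<open>W p\<close> in the quadratic form (x, W
  x).\<close>

definition quad_coeff :: "(nat \<Rightarrow> real) \<Rightarrow> nat \<times> nat \<Rightarrow> real" where
  "quad_coeff x p = (if fst p = snd p then 1 else 2) * (x (fst p) * x (snd p))"

definition spike :: "nat \<Rightarrow> real \<Rightarrow> (nat \<Rightarrow> real) \<Rightarrow> nat \<times> nat \<Rightarrow> real" where
  "spike N lam v p = lam / real N * v (fst p) * v (snd p)"

lemma sum_upairs_product:
  fixes x :: "nat \<Rightarrow> real"
  shows "(\<Sum>p\<in>upairs N. (if fst p = snd p then 1 else 2) * (x (fst p) * x (snd p))) = (\<Sum>i<N. x i)\<^sup>2"
proof -
  have "(\<Sum>i<N. x i)\<^sup>2 = (\<Sum>i<N. \<Sum>j<N. x i * x j)"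
    by (simp add: power2_eq_square sum_product)
  also have "\<dots> = (\<Sum>i<N. \<Sum>j<N. x (min i j) * x (max i j))"
    by (intro sum.cong refl) (auto simp: min_def max_def)
  also have "\<dots> = (\<Sum>p\<in>upairs N. (if fst p = snd p then 1 else 2) * (x (fst p) * x (snd p)))"
    using sum_upairs[of "\<lambda>p. x (fst p) * x (snd p)" N] by simp
  finally show ?thesis by simp
qed

lemma quad_observation:
  "inner_prod N x (mat_vec N (observation N lam v W) x) =
     lam / real N * (inner_prod N v x)\<^sup>2 + (\<Sum>p\<in>upairs N. quad_coeff x p * W p)"
proof -
  have "inner_prod N x (mat_vec N (observation N lam v W) x) =
      (\<Sum>i<N. \<Sum>j<N. x i * ((lam / real N * v i * v j + W (min i j, max i j)) * x j))"
    by (simp add: inner_prod_def mat_vec_def observation_def sum_distrib_left)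
  also have "\<dots> = (\<Sum>i<N. \<Sum>j<N. lam / real N * ((v i * x i) * (v j * x j))) +
      (\<Sum>i<N. \<Sum>j<N. x (min i j) * x (max i j) * W (min i j, max i j))"
    unfolding sum.distrib[symmetric]
    by (intro sum.cong refl) (auto simp: min_def max_def algebra_simps)
  also have "(\<Sum>i<N. \<Sum>j<N. lam / real N * ((v i * x i) * (v j * x j))) = lam / real N * (inner_prod N v x)\<^sup>2"
    unfolding inner_prod_def power2_eq_square sum_product by (simp add: sum_distrib_left)
  also have "(\<Sum>i<N. \<Sum>j<N. x (min i j) * x (max i j) * W (min i j, max i j)) = (\<Sum>p\<in>upairs N. quad_coeff x p * W p)"
    using sum_upairs[of "\<lambda>p. x (fst p) * x (snd p) * W p" N]
    by (simp add: quad_coeff_def mult.assoc)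
  finally show ?thesis .
qed

lemma noise_sd_square: "(noise_sd N p)\<^sup>2 = (if fst p = snd p then 2 else 1) / real N"
  by (simp add: noise_sd_def)

text \<open>The doubled variance on the diagonal balances the multiplicities: an off-diagonal pair
  contributes 4 * 1/N and a diagonal one 1 * 2/N, in both cases 2/N times the multiplicity. The sum
  is therefore a perfect square.\<close>

lemma quad_variance:
  "(\<Sum>p\<in>upairs N. (quad_coeff x p)\<^sup>2 * (noise_sd N p)\<^sup>2) = 2 / real N * (\<Sum>i<N. (x i)\<^sup>2)\<^sup>2"
  unfolding sum_upairs_product[symmetric] sum_distrib_left
  by (intro sum.cong refl) (auto simp: quad_coeff_def noise_sd_square power_mult_distrib)

text \<open>The same balance as in \<open>quad_variance\<close>: dividing by the variance gives a
  diagonal pair half the weight of an off-diagonal one. This is the exponent of the second moment of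
  the likelihood ratio.\<close>

lemma spike_energy:
  assumes "N > 0"
  shows "(\<Sum>p\<in>upairs N. (spike N lam v p)\<^sup>2 / (noise_sd N p)\<^sup>2) = lam\<^sup>2 / (2 * real N) * (\<Sum>i<N. (v i)\<^sup>2)\<^sup>2"
  unfolding sum_upairs_product[symmetric] sum_distrib_left
proof (rule sum.cong[OF refl])
  fix p
  show "(spike N lam v p)\<^sup>2 / (noise_sd N p)\<^sup>2 =
      lam\<^sup>2 / (2 * real N) * ((if fst p = snd p then 1 else 2) * ((v (fst p))\<^sup>2 * (v (snd p))\<^sup>2))"
    unfolding noise_sd_square spike_def using assms
    by (simp add: power_mult_distrib power_divide) (simp add: power2_eq_square power4_eq_xxxx)
qed

text \<open>At strength 0 the observation map only symmetrizes its argument, so \<open>v\<close>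
  enters solely as a translation of the noise, to which the change of measure applies. As
  \<open>v'\<close> is free, a single pure-noise map serves all \<open>v\<close>.\<close>

lemma observation_eq_shift:
  "observation N lam v W = observation N 0 v' (\<lambda>p\<in>upairs N. W p + spike N lam v p)"
  by (rule ext) (auto simp: observation_def upairs_def spike_def min_def max_def algebra_simps)

section \<open>Counting sparse vectors\<close>

lemma sparse_vecs_01: "x \<in> sparse_vecs N r \<Longrightarrow> i < N \<Longrightarrow> x i = 0 \<or> x i = 1"
  by (auto simp: sparse_vecs_def PiE_def Pi_def)

lemma sparse_vecs_sum_square:
  assumes "x \<in> sparse_vecs N r"
  shows "(\<Sum>i<N. (x i)\<^sup>2) = real N * r"
proof -
  have "(\<Sum>i<N. (x i)\<^sup>2) = (\<Sum>i<N. x i)"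
    using sparse_vecs_01[OF assms] by (intro sum.cong refl) fastforce
  then show ?thesis using assms by (simp add: sparse_vecs_def)
qed

lemma sum_indicator_lessThan: "(\<Sum>i<(N::nat). indicator V i :: real) = real (card ({..<N} \<inter> V))"
proof -
  have "(\<Sum>i<N. indicator V i :: real) = (\<Sum>i\<in>{..<N} \<inter> V. 1)"
    by (rule sum.mono_neutral_cong_right) auto
  then show ?thesis by simp
qed

lemma inner_prod_indicator:
  "inner_prod N (\<lambda>i\<in>{..<N}. indicator V i) (\<lambda>i\<in>{..<N}. indicator X i) = real (card ({..<N} \<inter> V \<inter> X))"
proof -
  have "inner_prod N (\<lambda>i\<in>{..<N}. indicator V i) (\<lambda>i\<in>{..<N}. indicator X i) = (\<Sum>i<N. indicator (V \<inter> X) i)"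
    unfolding inner_prod_def by (intro sum.cong refl) (auto simp: indicator_def)
  then show ?thesis by (simp add: sum_indicator_lessThan Int_assoc)
qed

text \<open>A 0/1 vector is the indicator of its support, which reduces all counting to subsets of
  size \<open>k\<close>.\<close>

lemma bij_betw_sparse_vecs:
  assumes "real N * r = real k"
  shows "bij_betw (\<lambda>V. \<lambda>i\<in>{..<N}. indicator V i) {V. V \<subseteq> {..<N} \<and> card V = k} (sparse_vecs N r)"
proof (rule bij_betw_byWitness[where f' = "\<lambda>x. {i. i < N \<and> x i = 1}"])
  show "\<forall>V\<in>{V. V \<subseteq> {..<N} \<and> card V = k}. {i. i < N \<and> (\<lambda>i\<in>{..<N}. indicator V i :: real) i = 1} = V"
    by (auto simp: indicator_def split: if_splits)
  show *: "\<forall>x\<in>sparse_vecs N r. (\<lambda>i\<in>{..<N}. indicator {i. i < N \<and> x i = 1} i) = x"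
  proof
    fix x assume x: "x \<in> sparse_vecs N r"
    show "(\<lambda>i\<in>{..<N}. indicator {i. i < N \<and> x i = 1} i) = x"
    proof
      fix i show "(\<lambda>i\<in>{..<N}. indicator {i. i < N \<and> x i = 1} i) i = x i"
        using x sparse_vecs_01[OF x, of i]
        by (cases "i < N") (auto simp: sparse_vecs_def PiE_def extensional_def)
    qed
  qed
  have card: "(\<Sum>i<N. (\<lambda>i\<in>{..<N}. indicator V i :: real) i) = real (card ({..<N} \<inter> V))" for V
    by (simp add: sum_indicator_lessThan)
  show "(\<lambda>V. \<lambda>i\<in>{..<N}. indicator V i :: real) ` {V. V \<subseteq> {..<N} \<and> card V = k} \<subseteq> sparse_vecs N r"
  proof clarify
    fix V assume "V \<subseteq> {..<N}" "k = card V"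
    then show "(\<lambda>i\<in>{..<N}. indicator V i) \<in> sparse_vecs N r"
      using assms card[of V] by (auto simp: sparse_vecs_def Int_absorb1 indicator_def)
  qed
  show "(\<lambda>x. {i. i < N \<and> x i = 1}) ` sparse_vecs N r \<subseteq> {V. V \<subseteq> {..<N} \<and> card V = k}"
  proof (clarsimp, intro conjI)
    fix x assume x: "x \<in> sparse_vecs N r"
    have "real (card {i. i < N \<and> x i = 1}) = (\<Sum>i<N. x i)"
      using card[of "{i. i < N \<and> x i = 1}"] * x
      by (simp add: Int_absorb1 subset_eq)
    then show "card {i. i < N \<and> x i = 1} = k"
      using x assms by (simp add: sparse_vecs_def)
  qed auto
qed

lemma card_sparse_vecs: "real N * r = real k \<Longrightarrow> card (sparse_vecs N r) = N choose k"
  using bij_betw_same_card[OF bij_betw_sparse_vecs, of N r k] by (simp add: n_subsets)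

lemma finite_sparse_vecs: "finite (sparse_vecs N r)"
  unfolding sparse_vecs_def by (rule finite_subset[of _ "{..<N} \<rightarrow>\<^sub>E {0, 1}"]) (auto intro!: finite_PiE)

text \<open>Each such \<open>V\<close> contains some \<open>m\<close>-subset \<open>S\<close> of
  \<open>X\<close>, and the rest of \<open>V\<close> is a subset of \<open>U - S\<close> of size
  \<open>k - m\<close>. A set \<open>V\<close> may arise from several \<open>S\<close>, hence only
  an inequality.\<close>

lemma card_large_intersection:
  assumes U: "finite U" "card U = N" and X: "X \<subseteq> U" "card X = k" and m: "m \<le> k"
  shows "card {V. V \<subseteq> U \<and> card V = k \<and> m \<le> card (V \<inter> X)} \<le> (k choose m) * ((N - m) choose (k - m))"
proof -
  let ?S = "{S. S \<subseteq> X \<and> card S = m}"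
  have finX: "finite X" using U X finite_subset by blast
  let ?F = "\<lambda>S. (\<lambda>T. T \<union> S) ` {T. T \<subseteq> U - S \<and> card T = k - m}"
  have "{V. V \<subseteq> U \<and> card V = k \<and> m \<le> card (V \<inter> X)} \<subseteq> (\<Union>S\<in>?S. ?F S)"
  proof
    fix V assume V: "V \<in> {V. V \<subseteq> U \<and> card V = k \<and> m \<le> card (V \<inter> X)}"
    then obtain S where S: "S \<subseteq> V \<inter> X" "card S = m" "finite S"
      by (auto elim: obtain_subset_with_card_n)
    then have "card (V - S) = k - m" using V by (subst card_Diff_subset) auto
    moreover have "V = (V - S) \<union> S" using S by auto
    ultimately have "V \<in> ?F S" using V by blast
    then show "V \<in> (\<Union>S\<in>?S. ?F S)" using S by auto
  qed
  then have "card {V. V \<subseteq> U \<and> card V = k \<and> m \<le> card (V \<inter> X)} \<le> card (\<Union>S\<in>?S. ?F S)"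
    using finX U by (intro card_mono) auto
  also have "\<dots> \<le> (\<Sum>S\<in>?S. card (?F S))"
    using finX by (intro card_UN_le) auto
  also have "\<dots> \<le> (\<Sum>S\<in>?S. (N - m) choose (k - m))"
  proof (rule sum_mono)
    fix S assume S: "S \<in> ?S"
    then have "finite S" "S \<subseteq> U" using finX X by (auto intro: finite_subset)
    then have "card (U - S) = N - m" using S U by (simp add: card_Diff_subset)
    then have "card {T. T \<subseteq> U - S \<and> card T = k - m} = (N - m) choose (k - m)"
      using U by (simp add: n_subsets)
    then show "card (?F S) \<le> (N - m) choose (k - m)"
      using U card_image_le[of "{T. T \<subseteq> U - S \<and> card T = k - m}" "\<lambda>T. T \<union> S"] by simp
  qed
  also have "\<dots> = (k choose m) * ((N - m) choose (k - m))"
    using finX X by (simp add: n_subsets)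
  finally show ?thesis .
qed

text \<open>Choosing an \<open>m\<close>-subset of a \<open>k\<close>-subset in either order
  rewrites the left side as the square of \<open>k choose m\<close>, divided by
  \<open>N choose m\<close>, times \<open>N choose k\<close>. The square is at most
  \<open>4 ^ k\<close>.\<close>

lemma binomial_quotient_le:
  assumes "m \<le> k" "k \<le> N" "0 < N"
  shows "real ((k choose m) * ((N - m) choose (k - m))) \<le> 4 ^ k * (real k / real N) ^ m * real (N choose k)"
proof -
  have km: "real (k choose m) \<le> 2 ^ k"
    using binomial_le_pow2[of k m] by (metis of_nat_le_iff of_nat_numeral of_nat_power)
  have pos: "real (N choose m) > 0" using assms by simp
  have "real (N choose k) * real (k choose m) = real (N choose m) * real ((N - m) choose (k - m))"
    using choose_mult[of m k N] assms by (metis of_nat_mult)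
  then have "real ((N - m) choose (k - m)) = real (N choose k) * real (k choose m) / real (N choose m)"
    using pos by (simp add: field_simps)
  then have "real ((k choose m) * ((N - m) choose (k - m))) =
      (real (k choose m))\<^sup>2 * (1 / real (N choose m)) * real (N choose k)"
    by (simp add: power2_eq_square)
  also have "\<dots> \<le> (2 ^ k)\<^sup>2 * (real k / real N) ^ m * real (N choose k)"
  proof (intro mult_right_mono mult_mono power_mono km)
    show "1 / real (N choose m) \<le> (real k / real N) ^ m"
    \<comment> \<open>For \<open>m = 0\<close> both sides are 1; otherwise \<open>N choose m\<close>
      is at least (N/m)^m, hence at least (N/k)^m.\<close>
    proof (cases "m = 0")
      case False
      have "(real N / real k) ^ m \<le> (real N / real m) ^ m"
        using assms False by (intro power_mono divide_left_mono) auto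
      also have "\<dots> \<le> real (N choose m)"
        using binomial_ge_n_over_k_pow_k[of m N, where 'a = real] assms by simp
      finally have "1 / real (N choose m) \<le> 1 / (real N / real k) ^ m"
        using assms False pos by (intro divide_left_mono) auto
      then show ?thesis by (simp add: power_divide)
    qed auto
  qed auto
  also have "(2 ^ k)\<^sup>2 = (4 ^ k :: real)"
    by (simp add: power2_eq_square power_mult_distrib[symmetric])
  finally show ?thesis .
qed

lemma card_large_overlap:
  assumes k: "real N * r = real k" "k \<le> N" "0 < N" and x: "x \<in> sparse_vecs N r"
  shows "real (card {v \<in> sparse_vecs N r. real m \<le> inner_prod N v x})
    \<le> 4 ^ k * (real k / real N) ^ m * real (card (sparse_vecs N r))"
proof -
  let ?e = "\<lambda>V. \<lambda>i\<in>{..<N}. indicator V i :: real"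
  from x bij_betw_sparse_vecs[OF k(1)] obtain X where X: "X \<subseteq> {..<N}" "card X = k" "x = ?e X"
    by (auto simp: bij_betw_def)
  have finX: "finite X" using X finite_subset by blast
  let ?B = "{V. V \<subseteq> {..<N} \<and> card V = k \<and> m \<le> card (V \<inter> X)}"
  have "{v \<in> sparse_vecs N r. real m \<le> inner_prod N v x} \<subseteq> ?e ` ?B"
  proof
    fix v assume v: "v \<in> {v \<in> sparse_vecs N r. real m \<le> inner_prod N v x}"
    with bij_betw_sparse_vecs[OF k(1)] obtain V where V: "V \<subseteq> {..<N}" "card V = k" "v = ?e V"
      by (auto simp: bij_betw_def)
    then have "real m \<le> real (card ({..<N} \<inter> V \<inter> X))"
      using v X by (simp only: mem_Collect_eq inner_prod_indicator)
    then show "v \<in> ?e ` ?B" using V by (auto simp: Int_absorb1)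
  qed
  then have le: "card {v \<in> sparse_vecs N r. real m \<le> inner_prod N v x} \<le> card ?B"
    by (intro surj_card_le[where f = ?e]) auto
  show ?thesis
  proof (cases "m \<le> k")
    case True
    have "card ?B \<le> (k choose m) * ((N - m) choose (k - m))"
      using X True by (intro card_large_intersection) auto
    with le have "real (card {v \<in> sparse_vecs N r. real m \<le> inner_prod N v x}) \<le> real ((k choose m) * ((N - m) choose (k - m)))"
      by linarith
    also have "\<dots> \<le> 4 ^ k * (real k / real N) ^ m * real (N choose k)"
      using True k by (intro binomial_quotient_le) auto
    finally show ?thesis using k by (simp add: card_sparse_vecs)
  next
    \<comment> \<open>Two sets of size \<open>k\<close> cannot meet in more than \<open>k\<close>
      points, so there is nothing to count.\<close>
    case False
    have "?B = {}"
    proof -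
      have *: "card (V \<inter> X) \<le> k" for V
        using X card_mono[OF finX, of "V \<inter> X"] by simp
      show ?thesis using False le_trans[OF _ *] by blast
    qed
    then have "card {v \<in> sparse_vecs N r. real m \<le> inner_prod N v x} = 0"
      using le by (simp only: card.empty le_zero_eq)
    then show ?thesis by simp
  qed
qed

text \<open>A single term of the expansion of (1 + x)^N is at most the whole, and 1 + x \<le> exp x.
  The parameter \<open>x\<close> is later taken to be \<rho>.\<close>

lemma binomial_le_exp:
  assumes "0 < x"
  shows "real (N choose k) \<le> exp (x * real N + real k * ln (1 / x))"
proof (cases "k \<le> N")
  case True
  have "real (N choose k) * x ^ k \<le> (\<Sum>j\<le>N. real (N choose j) * x ^ j * 1 ^ (N - j))"
    using assms True member_le_sum[of k "{..N}" "\<lambda>j. real (N choose j) * x ^ j * 1 ^ (N - j)"] by simp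
  also have "\<dots> = (x + 1) ^ N" by (rule binomial_ring[symmetric])
  also have "\<dots> \<le> exp x ^ N" using assms exp_ge_add_one_self[of x] by (intro power_mono) (auto simp: add.commute)
  also have "\<dots> = exp (x * real N)" by (simp add: exp_of_nat2_mult)
  finally have "real (N choose k) \<le> exp (x * real N) * (1 / x) ^ k"
    using assms by (simp add: field_simps power_divide)
  also have "(1 / x) ^ k = exp (real k * ln (1 / x))"
    using assms by (simp add: exp_of_nat_mult)
  finally show ?thesis by (simp add: exp_add)
qed (simp add: binomial_eq_0)

section \<open>Bounds on the success probability\<close>

definition support_size :: "real \<Rightarrow> nat \<Rightarrow> nat" where
  "support_size \<rho> N = nat \<lceil>real N * \<rho> - 1 / 2\<rceil>"

lemma support_size_eq:
  assumes "0 < \<rho>" "0 < N"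
  shows "real N * rho_seq \<rho> N = real (support_size \<rho> N)"
proof -
  have "0 < real N * \<rho>" using assms by simp
  then have "0 \<le> \<lceil>real N * \<rho> - 1/2\<rceil>" by linarith
  then show ?thesis using assms by (simp add: rho_seq_def support_size_def)
qed

lemma support_size_bounds:
  assumes "0 < \<rho>"
  shows "real (support_size \<rho> N) - 1 / 2 \<le> real N * \<rho>" "real N * \<rho> \<le> real (support_size \<rho> N) + 1 / 2"
proof -
  have "0 \<le> real N * \<rho>" using assms by simp
  then show "real (support_size \<rho> N) - 1 / 2 \<le> real N * \<rho>" "real N * \<rho> \<le> real (support_size \<rho> N) + 1 / 2"
    unfolding support_size_def by linarith+
qed

lemma support_size_le:
  assumes "0 < \<rho>" "\<rho> < 1"
  shows "support_size \<rho> N \<le> N"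
proof -
  have "real N * \<rho> \<le> real N * 1" using assms by (intro mult_left_mono) auto
  then have "\<lceil>real N * \<rho> - 1 / 2\<rceil> \<le> int N" by linarith
  then show ?thesis unfolding support_size_def by linarith
qed

lemma sparse_vecs_nonempty:
  assumes "0 < \<rho>" "\<rho> < 1" "0 < N"
  shows "sparse_vecs N (rho_seq \<rho> N) \<noteq> {}"
proof -
  have "card (sparse_vecs N (rho_seq \<rho> N)) > 0"
    using assms by (simp add: card_sparse_vecs[OF support_size_eq] support_size_le)
  then show ?thesis by auto
qed

lemma support_size_ratio_tendsto:
  assumes "0 < \<rho>"
  shows "(\<lambda>N. real (support_size \<rho> N) / real N) \<longlonglongrightarrow> \<rho>"
proof (rule tendsto_sandwich)
  show "(\<lambda>N. \<rho> - 1 / 2 / real N) \<longlonglongrightarrow> \<rho>" "(\<lambda>N. \<rho> + 1 / 2 / real N) \<longlonglongrightarrow> \<rho>"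
    by real_asymp+
  have "\<rho> - 1 / 2 / real N \<le> real (support_size \<rho> N) / real N \<and> real (support_size \<rho> N) / real N \<le> \<rho> + 1 / 2 / real N"
    if "0 < N" for N
  proof -
    have "(\<rho> - 1 / 2 / real N) * real N = real N * \<rho> - 1 / 2" "(\<rho> + 1 / 2 / real N) * real N = real N * \<rho> + 1 / 2"
      using that by (simp_all add: field_simps)
    then show ?thesis
      using support_size_bounds[OF assms, of N] that by (simp add: pos_le_divide_eq pos_divide_le_eq)
  qed
  then show "\<forall>\<^sub>F N in sequentially. \<rho> - 1 / 2 / real N \<le> real (support_size \<rho> N) / real N"
    "\<forall>\<^sub>F N in sequentially. real (support_size \<rho> N) / real N \<le> \<rho> + 1 / 2 / real N"
    by (auto intro: eventually_mono[OF eventually_gt_at_top[of 0]])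
qed

section \<open>From estimators to events of the noise, and bounds for fixed N\<close>

lemma estimator_sparse:
  "estimator \<rho> N f \<Longrightarrow> A \<in> space (sym_matrices N) \<Longrightarrow> f A \<in> sparse_vecs N (rho_seq \<rho> N)"
  unfolding estimator_def by (drule measurable_space) auto

text \<open>Pulls the success event back from the law of the observation to the noise space, where
  the Gaussian estimates apply; its measurability there is recorded for the later union and
  averaging arguments.\<close>

lemma success_prob_eq:
  assumes "estimator \<rho> N f"
  shows "success_prob c lam \<rho> N f v =
    measure (noise N) {W \<in> space (noise N). c * \<rho> * real N < inner_prod N v (f (observation N lam v W))}"
    "{W \<in> space (noise N). c * \<rho> * real N < inner_prod N v (f (observation N lam v W))} \<in> sets (noise N)"
proof -
  let ?B = "{A \<in> space (sym_matrices N). c * \<rho> * real N < inner_prod N v (f A)}"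
  \<comment> \<open>The overlap condition is cut down to the sparse vectors because only their
    subsets are sets of the target space.\<close>
  have "f -` ({x. c * \<rho> * real N < inner_prod N v x} \<inter> sparse_vecs N (rho_seq \<rho> N)) \<inter> space (sym_matrices N)
      \<in> sets (sym_matrices N)"
    using assms by (intro measurable_sets[of f _ "count_space (sparse_vecs N (rho_seq \<rho> N))"]) (auto simp: estimator_def)
  also have "f -` ({x. c * \<rho> * real N < inner_prod N v x} \<inter> sparse_vecs N (rho_seq \<rho> N)) \<inter> space (sym_matrices N) = ?B"
    using estimator_sparse[OF assms] by auto
  finally have B: "?B \<in> sets (sym_matrices N)" .
  have obs: "observation N lam v W \<in> space (sym_matrices N)" if "W \<in> space (noise N)" for W
    using measurable_space[OF measurable_observation that] .
  have eq: "observation N lam v -` ?B \<inter> space (noise N) =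
      {W \<in> space (noise N). c * \<rho> * real N < inner_prod N v (f (observation N lam v W))}"
    using obs by auto
  show "success_prob c lam \<rho> N f v =
    measure (noise N) {W \<in> space (noise N). c * \<rho> * real N < inner_prod N v (f (observation N lam v W))}"
    unfolding success_prob_def model_def space_distr measure_distr[OF measurable_observation B] eq ..
  show "{W \<in> space (noise N). c * \<rho> * real N < inner_prod N v (f (observation N lam v W))} \<in> sets (noise N)"
    using measurable_sets[OF measurable_observation B, of lam v] unfolding eq .
qed

lemma success_prob_bounds:
  assumes "estimator \<rho> N f"
  shows "0 \<le> success_prob c lam \<rho> N f v" "success_prob c lam \<rho> N f v \<le> 1"
  unfolding success_prob_eq(1)[OF assms]
  using prob_space.prob_le_1[OF prob_space_noise] by auto

text \<open>The infimum is at most the average over \<open>v\<close>. After the change of measure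
  the guess depends on the noise alone, so sum and expectation can be exchanged, and
  \<open>card_large_overlap\<close> bounds, for each noise, how many \<open>v\<close> the guess can
  match. The level \<open>T\<close> is left free.\<close>

lemma INF_success_prob_le:
  assumes \<rho>: "0 < \<rho>" "\<rho> < 1" and N: "0 < N" and f: "estimator \<rho> N f" and T: "0 < T"
    and m: "\<And>s::nat. c * \<rho> * real N < real s \<Longrightarrow> m \<le> s"
  defines "k \<equiv> support_size \<rho> N"
  shows "(INF v\<in>sparse_vecs N (rho_seq \<rho> N). success_prob c lam \<rho> N f v)
    \<le> T * (4 ^ k * (real k / real N) ^ m) + exp (lam\<^sup>2 / (2 * real N) * (real k)\<^sup>2) / T"
proof -
  let ?S = "sparse_vecs N (rho_seq \<rho> N)"
  define q where "q = 4 ^ k * (real k / real N) ^ m"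
  define E where "E = exp (lam\<^sup>2 / (2 * real N) * (real k)\<^sup>2)"
  interpret prob_space "noise N" by (rule prob_space_noise)
  \<comment> \<open>Success for \<open>v\<close> of the guess computed from pure noise; the guess is
    the same for every \<open>v\<close>.\<close>
  define A where "A v = {W \<in> space (noise N). c * \<rho> * real N < inner_prod N v (f (observation N 0 (\<lambda>_. 0) W))}" for v
  have fin: "finite ?S" by (rule finite_sparse_vecs)
  have card: "card ?S > 0"
    using sparse_vecs_nonempty[OF \<rho> N] fin by (simp add: card_gt_0_iff)
  have A: "A v \<in> sets (noise N)" for v
  proof -
    have "observation N 0 v = observation N 0 (\<lambda>_. 0)"
      by (intro ext) (simp add: observation_def)
    then show ?thesis using success_prob_eq(2)[OF f, of c v 0] by (simp add: A_def)
  qed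
  have bound: "success_prob c lam \<rho> N f v \<le> T * prob (A v) + E / T" if v: "v \<in> ?S" for v
  proof -
    have energy: "(\<Sum>p\<in>upairs N. (spike N lam v p)\<^sup>2 / (noise_sd N p)\<^sup>2) = lam\<^sup>2 / (2 * real N) * (real k)\<^sup>2"
      using N v \<rho> by (simp add: spike_energy sparse_vecs_sum_square k_def support_size_eq)
    have "success_prob c lam \<rho> N f v = prob {W \<in> space (noise N). (\<lambda>p\<in>upairs N. W p + spike N lam v p) \<in> A v}"
      unfolding success_prob_eq(1)[OF f] observation_eq_shift[of N lam v _ "\<lambda>_. 0"] A_def
      by (simp add: noise_eq_gauss space_gauss)
    also have "\<dots> \<le> T * prob (A v) + exp (\<Sum>p\<in>upairs N. (spike N lam v p)\<^sup>2 / (noise_sd N p)\<^sup>2) / T"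
      using A N T unfolding noise_eq_gauss
      by (intro measure_gauss_shift_le finite_upairs noise_sd_pos) auto
    finally show ?thesis unfolding energy E_def .
  qed
  have "(\<Sum>v\<in>?S. prob (A v)) = (\<integral>W. (\<Sum>v\<in>?S. indicator (A v) W) \<partial>noise N)"
    using A by (subst Bochner_Integration.integral_sum) (auto simp: emeasure_eq_measure intro!: integrable_real_indicator)
  also have "\<dots> \<le> (\<integral>W. q * real (card ?S) \<partial>noise N)"
  proof (rule integral_mono)
    show "integrable (noise N) (\<lambda>W. \<Sum>v\<in>?S. indicator (A v) W :: real)"
      using A by (intro Bochner_Integration.integrable_sum integrable_real_indicator) (auto simp: emeasure_eq_measure)
    fix W assume W: "W \<in> space (noise N)"
    let ?x = "f (observation N 0 (\<lambda>_. 0) W)"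
    have x: "?x \<in> ?S"
      by (rule estimator_sparse[OF f measurable_space[OF measurable_observation W]])
    have "(\<Sum>v\<in>?S. indicator (A v) W :: real) = real (card {v \<in> ?S. W \<in> A v})"
    proof -
      have "(\<Sum>v\<in>?S. indicator (A v) W :: real) = (\<Sum>v\<in>{v \<in> ?S. W \<in> A v}. 1)"
        using fin by (intro sum.mono_neutral_cong_right) auto
      then show ?thesis by simp
    qed
    also have "\<dots> \<le> real (card {v \<in> ?S. real m \<le> inner_prod N v ?x})"
    proof -
      \<comment> \<open>The overlap of two 0/1 vectors is an integer, so exceeding c \<rho> N makes
        it at least \<open>m\<close>.\<close>
      have "real m \<le> inner_prod N v ?x" if v: "v \<in> ?S" "W \<in> A v" for v
      proof -
        have "inner_prod N v ?x = (\<Sum>i<N. if v i = 1 \<and> ?x i = 1 then 1 else 0)"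
          unfolding inner_prod_def
          using sparse_vecs_01[OF v(1)] sparse_vecs_01[OF x] by (intro sum.cong refl) fastforce
        also have "\<dots> = real (card {i. i < N \<and> v i = 1 \<and> ?x i = 1})"
          by (subst sum.inter_filter[symmetric]) auto
        finally show ?thesis using v m by (auto simp: A_def)
      qed
      then show ?thesis using fin by (intro of_nat_mono card_mono) auto
    qed
    also have "\<dots> \<le> q * real (card ?S)"
      unfolding q_def k_def using N \<rho> support_size_eq[OF \<rho>(1) N] support_size_le[OF \<rho>] x by (intro card_large_overlap) auto
    finally show "(\<Sum>v\<in>?S. indicator (A v) W :: real) \<le> q * real (card ?S)" .
  qed auto
  finally have avg: "(\<Sum>v\<in>?S. prob (A v)) \<le> q * real (card ?S)" by (simp add: prob_space)
  let ?I = "INF v\<in>?S. success_prob c lam \<rho> N f v"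
  have "real (card ?S) * ?I = (\<Sum>v\<in>?S. ?I)" by simp
  also have "\<dots> \<le> (\<Sum>v\<in>?S. success_prob c lam \<rho> N f v)"
    by (intro sum_mono cINF_lower bdd_belowI[where m = 0]) (auto simp: success_prob_bounds(1)[OF f])
  also have "\<dots> \<le> (\<Sum>v\<in>?S. T * prob (A v) + E / T)" by (intro sum_mono bound)
  also have "\<dots> = T * (\<Sum>v\<in>?S. prob (A v)) + real (card ?S) * (E / T)"
    by (simp add: sum.distrib sum_distrib_left)
  also have "\<dots> \<le> T * (q * real (card ?S)) + real (card ?S) * (E / T)"
    using T avg by (intro add_right_mono mult_left_mono) auto
  also have "\<dots> = real (card ?S) * (T * q + E / T)" by (simp add: algebra_simps)
  finally have "?I \<le> T * q + E / T" using card by (simp only: mult_le_cancel_left_pos of_nat_0_less_iff)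
  then show ?thesis by (simp add: q_def E_def)
qed

text \<open>If the maximizer overlaps little with \<open>v\<close>, the noise must bridge the signal
  gap: the noise form is at most -aN at \<open>v\<close>, or at least bN at some candidate. The gap
  is split unevenly later: \<open>v\<close> is one fixed vector, so any \<open>a > 0\<close> gives
  decay, while \<open>b\<close> must beat the number of candidates.\<close>

lemma success_prob_ge:
  assumes \<rho>: "0 < \<rho>" "\<rho> < 1" and N: "0 < N" and f: "max_likelihood_estimator \<rho> N f"
    and v: "v \<in> sparse_vecs N (rho_seq \<rho> N)" and ab: "0 \<le> a" "0 \<le> b"
    and k: "k = support_size \<rho> N" "0 < k"
    and c: "0 \<le> c" and lam: "0 < lam"
    and gap: "(a + b) * real N < lam / real N * ((real k)\<^sup>2 - (c * \<rho> * real N)\<^sup>2)"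
  shows "1 - exp (- ((a * real N)\<^sup>2 / (4 * (real k)\<^sup>2 / real N)))
      - real (N choose k) * exp (- ((b * real N)\<^sup>2 / (4 * (real k)\<^sup>2 / real N))) \<le> success_prob c lam \<rho> N f v"
proof -
  let ?S = "sparse_vecs N (rho_seq \<rho> N)"
  let ?q = "\<lambda>x W. \<Sum>p\<in>upairs N. quad_coeff x p * W p"
  interpret prob_space "noise N" by (rule prob_space_noise)
  have est: "estimator \<rho> N f" using f by (simp add: max_likelihood_estimator_def)
  have Nk: "real N * rho_seq \<rho> N = real k" using support_size_eq[OF \<rho>(1) N] k by simp
  \<comment> \<open>Stating the bound for any \<open>d\<close> with the same squares covers both
    signs: \<open>- quad_coeff v\<close> for \<open>F\<close> and \<open>quad_coeff x\<close> for
    \<open>G x\<close>.\<close>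
  have tail: "prob {W \<in> space (noise N). t \<le> (\<Sum>p\<in>upairs N. d p * W p)} \<le> exp (- (t\<^sup>2 / (4 * (real k)\<^sup>2 / real N)))"
    if "0 \<le> t" "x \<in> ?S" "\<And>p. (d p)\<^sup>2 = (quad_coeff x p)\<^sup>2" for t x d
  proof -
    have "(\<Sum>p\<in>upairs N. (d p)\<^sup>2 * (noise_sd N p)\<^sup>2) = 2 * (real k)\<^sup>2 / real N"
      using that(2) by (simp add: that(3) quad_variance sparse_vecs_sum_square Nk)
    from gauss_tail[OF finite_upairs noise_sd_pos[OF N] this _ that(1)] show ?thesis
      using N k by (simp add: noise_eq_gauss)
  qed
  define F where "F = {W \<in> space (noise N). a * real N \<le> (\<Sum>p\<in>upairs N. - quad_coeff v p * W p)}"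
  define G where "G x = {W \<in> space (noise N). b * real N \<le> ?q x W}" for x
  define H where "H = {W \<in> space (noise N). c * \<rho> * real N < inner_prod N v (f (observation N lam v W))}"
  have [measurable]: "(\<lambda>W. \<Sum>p\<in>upairs N. d p * W p) \<in> borel_measurable (noise N)" for d
    unfolding noise_eq_gauss
    by (intro borel_measurable_sum borel_measurable_times measurable_gauss_component borel_measurable_const)
  have FG: "F \<in> events" "G x \<in> events" for x
    unfolding F_def G_def by measurable
  have H: "H \<in> events" unfolding H_def by (rule success_prob_eq(2)[OF est])
  have "space (noise N) \<subseteq> H \<union> (F \<union> (\<Union>x\<in>?S. G x))"
  proof
    fix W assume W: "W \<in> space (noise N)"
    let ?A = "observation N lam v W"
    let ?x = "f ?A"
    have A: "?A \<in> space (sym_matrices N)" by (rule measurable_space[OF measurable_observation W])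
    have max: "is_arg_max (\<lambda>x. inner_prod N x (mat_vec N ?A x)) (\<lambda>x. x \<in> ?S) ?x"
      using f A by (simp add: max_likelihood_estimator_def)
    then have x: "?x \<in> ?S" and "inner_prod N v (mat_vec N ?A v) \<le> inner_prod N ?x (mat_vec N ?A ?x)"
      using v by (auto simp: is_arg_max_def not_less)
    moreover have "inner_prod N v v = real k"
      using sparse_vecs_sum_square[OF v] Nk by (simp add: inner_prod_def power2_eq_square)
    ultimately have le: "lam / real N * (real k)\<^sup>2 + ?q v W \<le> lam / real N * (inner_prod N v ?x)\<^sup>2 + ?q ?x W"
      by (simp only: quad_observation)
    show "W \<in> H \<union> (F \<union> (\<Union>x\<in>?S. G x))"
    proof (rule ccontr)
      assume n: "W \<notin> H \<union> (F \<union> (\<Union>x\<in>?S. G x))"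
      \<comment> \<open>Nonnegativity lets the upper bound on the overlap be squared.\<close>
      have "0 \<le> inner_prod N v ?x"
        unfolding inner_prod_def using sparse_vecs_01[OF v] sparse_vecs_01[OF x] by (intro sum_nonneg) fastforce
      moreover have "inner_prod N v ?x \<le> c * \<rho> * real N" using n W by (auto simp: H_def)
      ultimately have "(inner_prod N v ?x)\<^sup>2 \<le> (c * \<rho> * real N)\<^sup>2" by (intro power_mono)
      then have "lam / real N * (inner_prod N v ?x)\<^sup>2 \<le> lam / real N * (c * \<rho> * real N)\<^sup>2"
        using lam by (intro mult_left_mono) auto
      moreover have "- ?q v W < a * real N" using n W by (auto simp: F_def sum_negf)
      moreover have "?q ?x W < b * real N" using n W x by (auto simp: G_def)
      ultimately show False using le gap by (simp add: right_diff_distrib distrib_right)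
    qed
  qed
  moreover have UG: "(\<Union>x\<in>?S. G x) \<in> events"
    using FG by (intro sets.finite_UN finite_sparse_vecs) auto
  ultimately have "prob (space (noise N)) \<le> prob (H \<union> (F \<union> (\<Union>x\<in>?S. G x)))"
    using H FG by (intro finite_measure_mono) auto
  also have "\<dots> \<le> prob H + prob (F \<union> (\<Union>x\<in>?S. G x))"
    using H FG UG by (intro measure_Un_le) auto
  also have "prob (F \<union> (\<Union>x\<in>?S. G x)) \<le> prob F + prob (\<Union>x\<in>?S. G x)"
    using H FG UG by (intro measure_Un_le) auto
  also have "prob (\<Union>x\<in>?S. G x) \<le> (\<Sum>x\<in>?S. prob (G x))"
    using FG finite_sparse_vecs by (intro measure_UNION_le) auto
  also have "\<dots> \<le> (\<Sum>x\<in>?S. exp (- ((b * real N)\<^sup>2 / (4 * (real k)\<^sup>2 / real N))))"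
    unfolding G_def using ab N by (intro sum_mono tail) auto
  also have "\<dots> = real (N choose k) * exp (- ((b * real N)\<^sup>2 / (4 * (real k)\<^sup>2 / real N)))"
    using card_sparse_vecs[OF Nk] by simp
  also have "prob F \<le> exp (- ((a * real N)\<^sup>2 / (4 * (real k)\<^sup>2 / real N)))"
    unfolding F_def using ab N v by (intro tail) auto
  finally have "1 \<le> prob H + (exp (- ((a * real N)\<^sup>2 / (4 * (real k)\<^sup>2 / real N))) +
      real (N choose k) * exp (- ((b * real N)\<^sup>2 / (4 * (real k)\<^sup>2 / real N))))"
    by (simp add: prob_space)
  moreover have "prob H = success_prob c lam \<rho> N f v"
    unfolding H_def by (rule success_prob_eq(1)[OF est, symmetric])
  ultimately show ?thesis by linarith
qed

section \<open>The two regimes\<close>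

text \<open>\<open>INF_success_prob_le\<close> is applied with
  \<open>T = exp (\<alpha> * real N)\<close>. The bound on \<open>lam\<close> keeps the second
  moment below exp(\<alpha> N / 2), and \<open>small\<close> keeps the counting term below exp(-2
  \<alpha> N), so both summands decay and the limit cannot be 1.\<close>

lemma not_recovers_approx:
  assumes \<rho>: "0 < \<rho>" "2 * \<rho> < 1" and c: "0 < c"
    and lam: "lam\<^sup>2 \<le> c / 16 * (1 / \<rho> * ln (1 / \<rho>))"
    and small: "2 * ln 4 + c * ln 2 \<le> c / 2 * ln (1 / \<rho>)"
    and f: "\<And>N. estimator \<rho> N (f N)"
  shows "\<not> recovers_approx c lam \<rho> f"
proof
  assume "recovers_approx c lam \<rho> f"
  then have lim: "(\<lambda>N. INF v\<in>sparse_vecs N (rho_seq \<rho> N). success_prob c lam \<rho> N (f N) v) \<longlonglongrightarrow> 1"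
    by (simp add: recovers_approx_def)
  define L where "L = ln (1 / \<rho>)"
  define \<alpha> where "\<alpha> = c / 4 * \<rho> * L"
  have L: "0 < L" using \<rho> by (simp add: L_def)
  have \<alpha>: "0 < \<alpha>" using c \<rho> L by (simp add: \<alpha>_def)
  \<comment> \<open>The crude bound k < 2 \<rho> N absorbs the rounding of the support size; its
    factor 2 is the source of \<open>c * ln 2\<close> in \<open>small\<close> and of one factor 2 in
    \<open>2 * ln 4\<close>.\<close>
  have "\<forall>\<^sub>F N in sequentially. real (support_size \<rho> N) / real N < 2 * \<rho>"
    using order_tendstoD(2)[OF support_size_ratio_tendsto[OF \<rho>(1)], of "2 * \<rho>"] \<rho> by simp
  then have ev: "\<forall>\<^sub>F N in sequentially. (INF v\<in>sparse_vecs N (rho_seq \<rho> N). success_prob c lam \<rho> N (f N) v)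
      \<le> exp (- \<alpha> * real N) + exp (- (\<alpha> / 2) * real N)"
    using eventually_gt_at_top[of 0]
  proof eventually_elim
    case (elim N)
    define k where "k = support_size \<rho> N"
    \<comment> \<open>The least integer strictly above c \<rho> N, as success is a strict
      inequality.\<close>
    define m where "m = nat \<lfloor>c * \<rho> * real N\<rfloor> + 1"
    have k: "real k \<le> 2 * \<rho> * real N" "real k / real N \<le> 2 * \<rho>"
      using elim by (simp_all add: k_def field_simps)
    have m: "c * \<rho> * real N \<le> real m"
      unfolding m_def by linarith
    have m': "m \<le> s" if "c * \<rho> * real N < real s" for s :: nat
    proof -
      have "0 \<le> c * \<rho> * real N" using c \<rho> by simp
      then have "nat \<lfloor>c * \<rho> * real N\<rfloor> < s" using that by linarith
      then show ?thesis by (simp add: m_def)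
    qed
    have "(4::real) ^ k = exp (real k * ln 4)" by (simp add: exp_of_nat_mult)
    also have "\<dots> \<le> exp (2 * \<rho> * real N * ln 4)" using k by (simp add: mult_right_mono)
    finally have 1: "(4::real) ^ k \<le> exp (2 * \<rho> * real N * ln 4)" .
    have "(real k / real N) ^ m \<le> (2 * \<rho>) ^ m" using k by (intro power_mono) auto
    also have "\<dots> = exp (real m * ln (2 * \<rho>))" using \<rho> by (simp add: exp_of_nat_mult)
    \<comment> \<open>Since 2 \<rho> < 1 the logarithm is negative, so a lower bound on
      \<open>m\<close> bounds the power from above.\<close>
    also have "\<dots> \<le> exp (c * \<rho> * real N * ln (2 * \<rho>))"
      using m \<rho> by (auto intro!: mult_right_mono_neg)
    finally have 2: "(real k / real N) ^ m \<le> exp (c * \<rho> * real N * ln (2 * \<rho>))" .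
    have "exp (\<alpha> * real N) * (4 ^ k * (real k / real N) ^ m) \<le>
        exp (\<alpha> * real N) * (exp (2 * \<rho> * real N * ln 4) * exp (c * \<rho> * real N * ln (2 * \<rho>)))"
      by (intro mult_left_mono mult_mono 1 2) auto
    also have "\<dots> = exp (real N * (\<alpha> + \<rho> * (2 * ln 4 + c * ln (2 * \<rho>))))"
      by (simp add: exp_add[symmetric] algebra_simps)
    also have "\<dots> \<le> exp (real N * (- \<alpha>))"
    proof -
      have "ln (2 * \<rho>) = ln 2 - L" using \<rho> by (simp add: L_def ln_mult ln_div)
      then have "2 * ln 4 + c * ln (2 * \<rho>) \<le> - (c / 2 * L)"
        using small unfolding L_def[symmetric] by (simp only: right_diff_distrib)
      then have "\<rho> * (2 * ln 4 + c * ln (2 * \<rho>)) \<le> \<rho> * (- (c / 2 * L))"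
        using \<rho> by (intro mult_left_mono) auto
      then have "\<alpha> + \<rho> * (2 * ln 4 + c * ln (2 * \<rho>)) \<le> - \<alpha>"
        by (simp add: \<alpha>_def algebra_simps)
      then show ?thesis by (simp only: exp_le_cancel_iff) (intro mult_left_mono, auto)
    qed
    finally have A: "exp (\<alpha> * real N) * (4 ^ k * (real k / real N) ^ m) \<le> exp (- \<alpha> * real N)"
      by (simp add: mult.commute)
    have "lam\<^sup>2 / (2 * real N) * (real k)\<^sup>2 \<le> lam\<^sup>2 / (2 * real N) * (2 * \<rho> * real N)\<^sup>2"
      using k by (intro mult_left_mono power_mono) auto
    also have "\<dots> = 2 * \<rho>\<^sup>2 * real N * lam\<^sup>2" using elim by (simp add: power2_eq_square)
    also have "\<dots> \<le> 2 * \<rho>\<^sup>2 * real N * (c / 16 * (1 / \<rho> * L))"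
      using lam unfolding L_def by (intro mult_left_mono) auto
    also have "\<dots> = \<alpha> / 2 * real N" using \<rho> by (simp add: \<alpha>_def power2_eq_square)
    finally have "exp (lam\<^sup>2 / (2 * real N) * (real k)\<^sup>2) / exp (\<alpha> * real N) \<le> exp (- (\<alpha> / 2) * real N)"
      unfolding exp_diff[symmetric] by simp
    moreover have "(INF v\<in>sparse_vecs N (rho_seq \<rho> N). success_prob c lam \<rho> N (f N) v) \<le>
        exp (\<alpha> * real N) * (4 ^ k * (real k / real N) ^ m) +
        exp (lam\<^sup>2 / (2 * real N) * (real k)\<^sup>2) / exp (\<alpha> * real N)"
      unfolding k_def using \<rho> elim by (intro INF_success_prob_le f m') auto
    ultimately show ?case using A by linarith
  qed
  have "(\<lambda>N. exp (- \<alpha> * real N) + exp (- (\<alpha> / 2) * real N)) \<longlonglongrightarrow> 0"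
    using \<alpha> by real_asymp
  then have "1 \<le> (0::real)"
    using lim ev by (rule tendsto_le[OF sequentially_bot])
  then show False by simp
qed

text \<open>The excess \<epsilon> over the threshold is shared out. In units of
  \<open>\<rho>\<^sup>2 * s\<close>, the signal gap exceeds (2 + \<epsilon>)(1 - c^2) = 2 +
  3\<epsilon>/4 by the choice of \<open>c\<close>, while \<open>a\<close> and \<open>b\<close>
  together take 2 + 5\<epsilon>/8. With 2 + \<epsilon>/2 for \<open>b\<close>, the tail beats the
  number of candidates once \<open>L * \<epsilon>\<close> exceeds 2, which is what \<rho> <
  exp(-2/\<epsilon>) provides.\<close>

lemma recovers_approx_max_likelihood:
  assumes \<epsilon>: "0 < \<epsilon>" and \<rho>: "0 < \<rho>" "\<rho> < 1" "\<rho> < exp (- (2 / \<epsilon>))"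
    and lam: "(2 + \<epsilon>) * sqrt (1 / \<rho> * ln (1 / \<rho>)) < lam"
    and f: "\<And>N. max_likelihood_estimator \<rho> N (f N)"
  shows "recovers_approx (sqrt (\<epsilon> / (4 * (2 + \<epsilon>)))) lam \<rho> f"
proof -
  define c where "c = sqrt (\<epsilon> / (4 * (2 + \<epsilon>)))"
  define L where "L = ln (1 / \<rho>)"
  define s where "s = sqrt (1 / \<rho> * L)"
  define a where "a = \<epsilon> / 8 * (\<rho>\<^sup>2 * s)"
  define b where "b = (2 + \<epsilon> / 2) * (\<rho>\<^sup>2 * s)"
  define r where "r N = real (support_size \<rho> N) / real N" for N
  have c: "0 \<le> c" "c\<^sup>2 = \<epsilon> / (4 * (2 + \<epsilon>))" using \<epsilon> by (simp_all add: c_def)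
  have "ln \<rho> < - (2 / \<epsilon>)" using \<rho> by (metis exp_less_cancel_iff exp_ln)
  then have L: "2 < L * \<epsilon>" "0 < L" using \<epsilon> \<rho> by (simp_all add: L_def ln_div field_simps)
  have s: "0 < s" "s\<^sup>2 = L / \<rho>" using L \<rho> by (simp_all add: s_def)
  have "0 < (2 + \<epsilon>) * s" using s \<epsilon> by simp
  with lam have lam0: "0 < lam" by (simp add: s_def L_def)
  have ab: "0 < a" "0 < b" using \<epsilon> \<rho> s by (simp_all add: a_def b_def)
  have r: "r \<longlonglongrightarrow> \<rho>" using support_size_ratio_tendsto[OF \<rho>(1)] by (simp add: r_def[abs_def])
  have gap: "a + b < lam * (\<rho>\<^sup>2 - (c * \<rho>)\<^sup>2)"
  proof -
    have e: "1 - c\<^sup>2 = (8 + 3 * \<epsilon>) / (4 * (2 + \<epsilon>))" using \<epsilon> by (simp add: c(2) field_simps)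
    have "a + b = (2 + 5 / 8 * \<epsilon>) * (\<rho>\<^sup>2 * s)" by (simp add: a_def b_def algebra_simps)
    also have "\<dots> < (2 + 3 / 4 * \<epsilon>) * (\<rho>\<^sup>2 * s)" using \<epsilon> \<rho> s by (intro mult_strict_right_mono) auto
    also have "\<dots> = (2 + \<epsilon>) * s * ((1 - c\<^sup>2) * \<rho>\<^sup>2)" unfolding e using \<epsilon> by (simp add: field_simps)
    also have "\<dots> < lam * ((1 - c\<^sup>2) * \<rho>\<^sup>2)"
      using lam \<rho> \<epsilon> e by (intro mult_strict_right_mono) (auto simp: s_def L_def)
    finally show ?thesis by (simp add: algebra_simps power_mult_distrib)
  qed
  have "0 < a\<^sup>2 / (4 * \<rho>\<^sup>2)" using ab \<rho> by simp
  \<comment> \<open>Any rate strictly below the limiting tail exponent of the noise form at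
    \<open>v\<close>; the slack allows the actual support size for large N.\<close>
  then obtain \<delta> where \<delta>: "0 < \<delta>" "\<delta> < a\<^sup>2 / (4 * \<rho>\<^sup>2)" using dense by blast
  \<comment> \<open>\<open>\<rho> + \<rho> * L\<close> is the limiting rate of
    \<open>binomial_le_exp\<close> at \<open>x = \<rho>\<close>. The tail rate is \<rho> L (1 +
    \<epsilon>/4)^2, and its surplus of at least \<rho> L \<epsilon>/2 pays for the extra
    \<rho>.\<close>
  have "\<rho> + \<rho> * L - b\<^sup>2 / (4 * \<rho>\<^sup>2) < 0"
  proof -
    have "b\<^sup>2 / (4 * \<rho>\<^sup>2) = (2 + \<epsilon> / 2)\<^sup>2 / 4 * (\<rho> * L)"
      using \<rho> by (simp add: b_def power_mult_distrib s(2)) (simp add: field_simps power2_eq_square power4_eq_xxxx)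
    also have "\<dots> = \<rho> * (L + L * \<epsilon> / 2 + \<epsilon>\<^sup>2 * L / 16)" by (simp add: power2_eq_square algebra_simps)
    also have "\<dots> > \<rho> * (L + 1)"
    proof (intro mult_strict_left_mono \<rho>)
      have "0 \<le> \<epsilon>\<^sup>2 * L / 16" using L by simp
      then show "L + 1 < L + L * \<epsilon> / 2 + \<epsilon>\<^sup>2 * L / 16" using L(1) by linarith
    qed
    finally show ?thesis by (simp add: algebra_simps)
  qed
  then obtain \<eta> where \<eta>: "0 < \<eta>" "\<rho> + \<rho> * L - b\<^sup>2 / (4 * \<rho>\<^sup>2) < - \<eta>"
    using dense[of "\<rho> + \<rho> * L - b\<^sup>2 / (4 * \<rho>\<^sup>2)" 0] by (metis neg_less_0_iff_less minus_minus)
  \<comment> \<open>By continuity, the strict inequalities at \<rho> persist for the ratio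
    \<open>r N\<close> when N is large.\<close>
  have "\<forall>\<^sub>F N in sequentially. \<delta> < a\<^sup>2 / (4 * (r N)\<^sup>2)"
    by (rule order_tendstoD(1)[OF _ \<delta>(2)]) (use \<rho> in \<open>auto intro!: tendsto_intros r\<close>)
  moreover have "\<forall>\<^sub>F N in sequentially. \<rho> + r N * L - b\<^sup>2 / (4 * (r N)\<^sup>2) < - \<eta>"
    by (rule order_tendstoD(2)[OF _ \<eta>(2)]) (use \<rho> in \<open>auto intro!: tendsto_intros r\<close>)
  moreover have "\<forall>\<^sub>F N in sequentially. a + b < lam * ((r N)\<^sup>2 - (c * \<rho>)\<^sup>2)"
    by (rule order_tendstoD(1)[OF _ gap]) (auto intro!: tendsto_intros r)
  moreover have "\<forall>\<^sub>F N in sequentially. 0 < r N"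
    by (rule order_tendstoD(1)[OF r \<rho>(1)])
  ultimately have low: "\<forall>\<^sub>F N in sequentially. 1 - exp (- \<delta> * real N) - exp (- \<eta> * real N) \<le>
      (INF v\<in>sparse_vecs N (rho_seq \<rho> N). success_prob c lam \<rho> N (f N) v)"
    using eventually_gt_at_top[of 0]
  proof eventually_elim
    case (elim N)
    define k where "k = support_size \<rho> N"
    have rk: "real k = r N * real N" using elim by (simp add: r_def k_def)
    have k: "0 < k" using elim rk by (metis mult_pos_pos of_nat_0_less_iff)
    have expo: "(x * real N)\<^sup>2 / (4 * (real k)\<^sup>2 / real N) = real N * (x\<^sup>2 / (4 * (r N)\<^sup>2))" for x
      unfolding rk using elim by (simp add: power2_eq_square field_simps)
    have g: "(a + b) * real N < lam / real N * ((real k)\<^sup>2 - (c * \<rho> * real N)\<^sup>2)"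
    proof -
      have "lam / real N * ((real k)\<^sup>2 - (c * \<rho> * real N)\<^sup>2) = lam * ((r N)\<^sup>2 - (c * \<rho>)\<^sup>2) * real N"
        unfolding rk using elim by (simp add: power2_eq_square field_simps)
      then show ?thesis using elim by simp
    qed
    have 1: "exp (- ((a * real N)\<^sup>2 / (4 * (real k)\<^sup>2 / real N))) \<le> exp (- \<delta> * real N)"
    proof -
      have "real N * \<delta> \<le> real N * (a\<^sup>2 / (4 * (r N)\<^sup>2))" using elim by (intro mult_left_mono) auto
      then show ?thesis unfolding expo by (simp only: exp_le_cancel_iff minus_mult_left[symmetric] neg_le_iff_le mult.commute)
    qed
    have "real (N choose k) * exp (- ((b * real N)\<^sup>2 / (4 * (real k)\<^sup>2 / real N))) \<le>
        exp (\<rho> * real N + real k * L) * exp (- ((b * real N)\<^sup>2 / (4 * (real k)\<^sup>2 / real N)))"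
      unfolding L_def by (intro mult_right_mono binomial_le_exp \<rho>) auto
    also have "\<dots> = exp (real N * (\<rho> + r N * L - b\<^sup>2 / (4 * (r N)\<^sup>2)))"
      unfolding expo exp_add[symmetric] by (simp add: rk algebra_simps)
    also have "\<dots> \<le> exp (real N * (- \<eta>))"
      using elim by (simp only: exp_le_cancel_iff) (intro mult_left_mono, auto)
    finally have 2: "real (N choose k) * exp (- ((b * real N)\<^sup>2 / (4 * (real k)\<^sup>2 / real N))) \<le> exp (- \<eta> * real N)"
      by (simp add: mult.commute)
    show ?case
    proof (rule cINF_greatest)
      show "sparse_vecs N (rho_seq \<rho> N) \<noteq> {}" using \<rho> elim by (intro sparse_vecs_nonempty) auto
      fix v assume v: "v \<in> sparse_vecs N (rho_seq \<rho> N)"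
      from success_prob_ge[OF \<rho>(1,2) _ f v _ _ k_def k c(1) lam0 g] 1 2 ab elim
      show "1 - exp (- \<delta> * real N) - exp (- \<eta> * real N) \<le> success_prob c lam \<rho> N (f N) v"
        by linarith
    qed
  qed
  \<comment> \<open>For the upper half of the sandwich, one sparse vector suffices to bound the
    infimum by 1.\<close>
  have up: "\<forall>\<^sub>F N in sequentially. (INF v\<in>sparse_vecs N (rho_seq \<rho> N). success_prob c lam \<rho> N (f N) v) \<le> 1"
    using eventually_gt_at_top[of 0]
  proof eventually_elim
    case (elim N)
    have est: "estimator \<rho> N (f N)" using f by (simp add: max_likelihood_estimator_def)
    obtain v where v: "v \<in> sparse_vecs N (rho_seq \<rho> N)" using sparse_vecs_nonempty[OF \<rho>(1,2) elim] by blast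
    show ?case
      by (rule cINF_lower2[OF _ v]) (auto simp: success_prob_bounds[OF est] intro!: bdd_belowI[where m = 0])
  qed
  have "(\<lambda>N. 1 - exp (- \<delta> * real N) - exp (- \<eta> * real N)) \<longlonglongrightarrow> 1"
    using \<delta>(1) \<eta>(1) by real_asymp
  from tendsto_sandwich[OF low up this tendsto_const] show ?thesis
    by (simp add: recovers_approx_def c_def)
qed

section \<open>Assembly of the two regimes\<close>

theorem theorem1p2:
  shows "(\<forall>lam :: real \<Rightarrow> real.
      (\<forall>\<rho>\<in>{0<..<1}. lam \<rho> > 0) \<longrightarrow>
      lam \<in> o[at_right 0](\<lambda>\<rho>. sqrt (1 / \<rho> * ln (1 / \<rho>))) \<longrightarrow>
      \<not> (\<exists>c>0. \<exists>\<rho>0\<in>{0<..<1}. \<exists>f :: real \<Rightarrow> nat \<Rightarrow> (nat \<times> nat \<Rightarrow> real) \<Rightarrow> nat \<Rightarrow> real.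
           \<forall>\<rho>\<in>{0<..<\<rho>0}. (\<forall>N. estimator \<rho> N (f \<rho> N)) \<and> recovers_approx c (lam \<rho>) \<rho> (f \<rho>)))
    \<and> (\<forall>\<epsilon>>0. \<exists>c>0. \<exists>\<rho>0>0. \<forall>\<rho>\<in>{0<..<1}. \<rho> < \<rho>0 \<longrightarrow>
        (\<forall>lam > (2 + \<epsilon>) * sqrt (1 / \<rho> * ln (1 / \<rho>)).
          \<forall>f. (\<forall>N. max_likelihood_estimator \<rho> N (f N)) \<longrightarrow> recovers_approx c lam \<rho> f))"
proof (intro conjI allI impI)
  fix lam :: "real \<Rightarrow> real"
  assume lam: "lam \<in> o[at_right 0](\<lambda>\<rho>. sqrt (1 / \<rho> * ln (1 / \<rho>)))"
  show "\<not> (\<exists>c>0. \<exists>\<rho>0\<in>{0<..<1}. \<exists>f :: real \<Rightarrow> nat \<Rightarrow> (nat \<times> nat \<Rightarrow> real) \<Rightarrow> nat \<Rightarrow> real.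
           \<forall>\<rho>\<in>{0<..<\<rho>0}. (\<forall>N. estimator \<rho> N (f \<rho> N)) \<and> recovers_approx c (lam \<rho>) \<rho> (f \<rho>))"
  proof clarify
    fix c \<rho>0 :: real and f :: "real \<Rightarrow> nat \<Rightarrow> (nat \<times> nat \<Rightarrow> real) \<Rightarrow> nat \<Rightarrow> real"
    assume c: "0 < c" and \<rho>0: "\<rho>0 \<in> {0<..<1}"
      and f: "\<forall>\<rho>\<in>{0<..<\<rho>0}. (\<forall>N. estimator \<rho> N (f \<rho> N)) \<and> recovers_approx c (lam \<rho>) \<rho> (f \<rho>)"
    \<comment> \<open>The constant \<open>sqrt c / 4\<close> squares to the \<open>c / 16\<close> of
      \<open>not_recovers_approx\<close>.\<close>
    have "\<forall>\<^sub>F \<rho> in at_right 0. norm (lam \<rho>) \<le> sqrt c / 4 * norm (sqrt (1 / \<rho> * ln (1 / \<rho>)))"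
      using c by (intro landau_o.smallD[OF lam]) auto
    moreover have "\<forall>\<^sub>F \<rho>::real in at_right 0. 2 * ln 4 + c * ln 2 \<le> c / 2 * ln (1 / \<rho>)"
    proof -
      have "filterlim (\<lambda>\<rho>::real. c / 2 * ln (1 / \<rho>)) at_top (at_right 0)"
        using c by real_asymp
      then show ?thesis unfolding filterlim_at_top by blast
    qed
    moreover have "\<forall>\<^sub>F \<rho> in at_right 0. \<rho> \<in> {0<..<min \<rho>0 (1 / 2)}"
      using \<rho>0 by (intro eventually_at_right_real) auto
    \<comment> \<open>All the conditions hold at once for small \<rho> > 0, and each such \<rho> is
      contradictory; the right neighborhoods of 0 are nontrivial.\<close>
    ultimately have "\<forall>\<^sub>F \<rho>::real in at_right 0. False"
    proof eventually_elim
      case (elim \<rho>)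
      then have \<rho>: "0 < \<rho>" "2 * \<rho> < 1" "\<rho> \<in> {0<..<\<rho>0}" by auto
      have "0 \<le> 1 / \<rho> * ln (1 / \<rho>)" using \<rho> by simp
      then have sq: "(sqrt c / 4 * norm (sqrt (1 / \<rho> * ln (1 / \<rho>))))\<^sup>2 = c / 16 * (1 / \<rho> * ln (1 / \<rho>))"
        using c by (simp add: power_mult_distrib power_divide)
      have "(lam \<rho>)\<^sup>2 = (norm (lam \<rho>))\<^sup>2" by simp
      also have "\<dots> \<le> c / 16 * (1 / \<rho> * ln (1 / \<rho>))"
        unfolding sq[symmetric] using elim by (intro power_mono) auto
      finally show False
        using not_recovers_approx[OF \<rho>(1,2) c _ elim(2), of "lam \<rho>" "f \<rho>"] f \<rho> by blast
    qed
    then show False by simp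
  qed
next
  fix \<epsilon> :: real
  assume \<epsilon>: "0 < \<epsilon>"
  show "\<exists>c>0. \<exists>\<rho>0>0. \<forall>\<rho>\<in>{0<..<1}. \<rho> < \<rho>0 \<longrightarrow>
        (\<forall>lam > (2 + \<epsilon>) * sqrt (1 / \<rho> * ln (1 / \<rho>)).
          \<forall>f. (\<forall>N. max_likelihood_estimator \<rho> N (f N)) \<longrightarrow> recovers_approx c lam \<rho> f)"
  proof (intro exI conjI ballI impI allI)
    \<comment> \<open>Both witnesses depend on \<epsilon> alone, so \<rho> and \<open>lam\<close>
      may be chosen after them.\<close>
    show "0 < sqrt (\<epsilon> / (4 * (2 + \<epsilon>)))" "0 < exp (- (2 / \<epsilon>))" using \<epsilon> by simp_all
  next
    fix \<rho> lam :: real and f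
    assume "\<rho> \<in> {0<..<1}" "\<rho> < exp (- (2 / \<epsilon>))" "(2 + \<epsilon>) * sqrt (1 / \<rho> * ln (1 / \<rho>)) < lam"
      "\<forall>N. max_likelihood_estimator \<rho> N (f N)"
    then show "recovers_approx (sqrt (\<epsilon> / (4 * (2 + \<epsilon>)))) lam \<rho> f"
      using \<epsilon> by (intro recovers_approx_max_likelihood) auto
  qed
qed

end
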